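(* Let $(\Omega,\mathcal A,\mu)$ be a $\sigma$-finite measure space. Let $K$ be a random compact set in $\mathbb{C}^n$ whose range $\{K(\omega):\omega\in\Omega\}$ consists of at most a countable number of different compact sets. Suppose that $K$ is polynomially convex, i.e., $K(\omega)=\widehat{K(\omega)}$ for all $\omega\in\Omega$. Let $f$ be a generalized random function on $\operatorname{Gr}K$ such that $f(\omega,\cdot)$ is holomorphic in a neighborhood of $K(\omega)$ for each $\omega$, and let $\varepsilon$ be a positive measurable function defined on $\Omega$. Then there exists a generalized random polynomial $p$ such that $$\|p(\omega,\cdot)-f(\omega,\cdot)\|_{K(\omega)}<\varepsilon(\omega)$$ for all $\omega$ outside a measurable set $L\subset\Omega$ with $\mu(L)=0$.
   Context: $\mathcal K'(\mathbb{C}^n)$ denotes the space of non-empty compact subsets of $\mathbb{C}^n$ with the Hausdorff distance and its Borel $\sigma$-algebra. A random compact set in $\mathbb{C}^n$ is a measurable function $K:\Omega\to\mathcal K'(\mathbb{C}^n)$. Its graph is $\operatorname{Gr}K=\{(\omega,z)\in\Omega\times\mathbb{C}^n: z\in K(\omega)\}$, and $K^{-1}(z)=\{\omega\in\Omega: z\in K(\omega)\}$, which is a measurable set. A generalized random function is a function $f:\operatorname{Gr}K\to\mathbb{C}$ such that, for each $z\in\mathbb{C}^n$ with $K^{-1}(z)\neq\emptyset$, the function $f(\cdot,z):K^{-1}(z)\to\mathbb{C}$ is measurable. The condition "$f(\omega,\cdot)$ is holomorphic in a neighborhood of $K(\omega)$" means that $f(\omega,\cdot)$, defined on $K(\omega)$,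 is the restriction to $K(\omega)$ of a function holomorphic on some open neighborhood (depending on $\omega$) of $K(\omega)$. A generalized random polynomial is a generalized random function $p$ on $\operatorname{Gr}K$ such that, for each $\omega$, $p(\omega,\cdot)$ is (the restriction to $K(\omega)$ of) a complex polynomial on $\mathbb{C}^n$. For compact $Q\subset\mathbb{C}^n$, $\widehat Q=\{z\in\mathbb{C}^n:|p(z)|\le\max_{x\in Q}|p(x)|\text{ for all complex polynomials }p\text{ on }\mathbb{C}^n\}$ is the polynomially convex hull, and $\|g\|_Q=\sup_{z\in Q}|g(z)|$. *)

theory Defs
  imports "HOL-Analysis.Analysis"
begin

section \<open>Non-empty compact sets with the Hausdorff distance\<close>

definition nonempty_compacts :: "'b::metric_space set set" where
  "nonempty_compacts = {K. K \<noteq> {} \<and> compact K}"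

text \<open>The value 0 outside the non-empty compact sets is a dummy; it is only there because the
  locale \<^locale>\<open>Metric_space\<close> asks for a distance that is non-negative on the whole type.\<close>

definition hausdorff_dist :: "'b::metric_space set \<Rightarrow> 'b set \<Rightarrow> real" where
  "hausdorff_dist A B =
     (if A \<in> nonempty_compacts \<and> B \<in> nonempty_compacts
      then max (SUP x\<in>A. infdist x B) (SUP y\<in>B. infdist y A) else 0)"

lemma hausdorff_dist_le_iff:
  assumes "A \<in> nonempty_compacts" "B \<in> nonempty_compacts"
  shows "hausdorff_dist A B \<le> r \<longleftrightarrow>
           (\<forall>x\<in>A. infdist x B \<le> r) \<and> (\<forall>y\<in>B. infdist y A \<le> r)"
proof -
  have bdd: "bdd_above ((\<lambda>x. infdist x D) ` C)" if "compact C" for C D :: "'a set"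
    by (intro bounded_imp_bdd_above compact_imp_bounded compact_continuous_image that)
       (intro continuous_intros)
  have ne: "A \<noteq> {}" "compact A" "B \<noteq> {}" "compact B"
    using assms by (auto simp: nonempty_compacts_def)
  show ?thesis
    using assms by (simp add: hausdorff_dist_def cSUP_le_iff bdd ne)
qed

lemma infdist_le_hausdorff_dist:
  assumes "A \<in> nonempty_compacts" "B \<in> nonempty_compacts" "x \<in> A"
  shows "infdist x B \<le> hausdorff_dist A B"
  using hausdorff_dist_le_iff[OF assms(1,2), of "hausdorff_dist A B"] assms(3) by auto

lemma hausdorff_dist_commute: "hausdorff_dist A B = hausdorff_dist B A"
  by (simp add: hausdorff_dist_def max.commute)

lemma infdist_hausdorff_triangle:
  assumes "A \<in> nonempty_compacts" "B \<in> nonempty_compacts" "C \<in> nonempty_compacts" "x \<in> A"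
  shows "infdist x C \<le> hausdorff_dist A B + hausdorff_dist B C"
proof -
  have "compact B" "B \<noteq> {}" using assms(2) by (auto simp: nonempty_compacts_def)
  then obtain y where y: "y \<in> B" "\<forall>b\<in>B. dist x y \<le> dist x b"
    using continuous_attains_inf[of B "dist x"] continuous_on_dist[OF continuous_on_const continuous_on_id]
    by blast
  then have "dist x y \<le> infdist x B"
    using \<open>B \<noteq> {}\<close> by (simp add: infdist_def cINF_greatest)
  have "infdist x C \<le> infdist y C + dist x y" by (rule infdist_triangle)
  also have "\<dots> \<le> hausdorff_dist B C + hausdorff_dist A B"
    using infdist_le_hausdorff_dist[OF assms(2,3) y(1)]
      infdist_le_hausdorff_dist[OF assms(1,2,4)] \<open>dist x y \<le> infdist x B\<close> by linarith
  finally show ?thesis by simp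
qed

lemma Metric_space_hausdorff: "Metric_space nonempty_compacts hausdorff_dist"
proof
  show "0 \<le> hausdorff_dist A B" for A B :: "'a set"
  proof (cases "A \<in> nonempty_compacts \<and> B \<in> nonempty_compacts")
    case True
    then obtain a where "a \<in> A" by (auto simp: nonempty_compacts_def)
    then show ?thesis
      using infdist_le_hausdorff_dist[of A B a] infdist_nonneg[of a B] True by linarith
  qed (auto simp: hausdorff_dist_def)
next
  fix A B :: "'a set"
  show "hausdorff_dist A B = hausdorff_dist B A" by (rule hausdorff_dist_commute)
next
  fix A B :: "'a set"
  assume AB: "A \<in> nonempty_compacts" "B \<in> nonempty_compacts"
  then have cl: "closed A" "A \<noteq> {}" "closed B" "B \<noteq> {}"
    by (auto simp: nonempty_compacts_def compact_imp_closed)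
  show "hausdorff_dist A B = 0 \<longleftrightarrow> A = B"
  proof
    assume "hausdorff_dist A B = 0"
    then have "\<forall>x\<in>A. infdist x B \<le> 0" "\<forall>y\<in>B. infdist y A \<le> 0"
      using hausdorff_dist_le_iff[OF AB, of 0] by auto
    then have "\<forall>x\<in>A. infdist x B = 0" "\<forall>y\<in>B. infdist y A = 0"
      by (meson antisym infdist_nonneg)+
    then show "A = B" using cl in_closed_iff_infdist_zero by blast
  next
    assume "A = B"
    then show "hausdorff_dist A B = 0"
      using AB cl by (simp add: hausdorff_dist_def)
  qed
next
  fix A B C :: "'a set"
  assume ABC: "A \<in> nonempty_compacts" "B \<in> nonempty_compacts" "C \<in> nonempty_compacts"
  have "infdist y A \<le> hausdorff_dist A B + hausdorff_dist B C" if "y \<in> C" for y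
    using infdist_hausdorff_triangle[OF ABC(3,2,1) that]
    by (simp add: hausdorff_dist_commute add.commute)
  then show "hausdorff_dist A C \<le> hausdorff_dist A B + hausdorff_dist B C"
    using ABC by (simp add: hausdorff_dist_le_iff infdist_hausdorff_triangle)
qed

definition hausdorff_borel :: "'b::metric_space set measure" where
  "hausdorff_borel =
     sigma nonempty_compacts
       {U. openin (Metric_space.mtopology nonempty_compacts hausdorff_dist) U}"

lemma space_hausdorff_borel [simp]: "space hausdorff_borel = nonempty_compacts"
  unfolding hausdorff_borel_def
  using openin_subset[of "Metric_space.mtopology nonempty_compacts hausdorff_dist"]
    Metric_space.topspace_mtopology[OF Metric_space_hausdorff]
  by (intro space_measure_of) auto


section \<open>Polynomials, holomorphic functions and polynomial hulls in several variables\<close>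

text \<open>A finite sum over multi-indices, with \<open>\<alpha> i\<close> the exponent of the \<open>i\<close>-th coordinate.\<close>

definition complex_polynomial :: "(complex^'n \<Rightarrow> complex) \<Rightarrow> bool" where
  "complex_polynomial q \<longleftrightarrow>
     (\<exists>A c. finite A \<and> (\<forall>z. q z = (\<Sum>\<alpha>\<in>A. c \<alpha> * (\<Prod>i\<in>UNIV. (z $ i) ^ (\<alpha> i :: nat)))))"

text \<open>\<open>complex^'n\<close> is only a real normed space in the library, so complex linearity of
  the Frechet derivative is required explicitly.\<close>

definition holomorphic_several ::
    "(complex^'n \<Rightarrow> complex) \<Rightarrow> (complex^'n) set \<Rightarrow> bool" where
  "holomorphic_several h U \<longleftrightarrow>
     (\<forall>z\<in>U. \<exists>D. (h has_derivative D) (at z) \<and> (\<forall>c v. D (c *s v) = c * D v))"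

definition holomorphic_near ::
    "(complex^'n \<Rightarrow> complex) \<Rightarrow> (complex^'n) set \<Rightarrow> bool" where
  "holomorphic_near g Q \<longleftrightarrow>
     (\<exists>U h. open U \<and> Q \<subseteq> U \<and> holomorphic_several h U \<and> (\<forall>z\<in>Q. g z = h z))"

text \<open>As a supremum in \<open>real\<close>, this is meaningful for \<open>g\<close> bounded on \<open>Q \<noteq> {}\<close>; below, \<open>Q\<close> is
  always compact and non-empty and \<open>g\<close> continuous on \<open>Q\<close>.\<close>

definition sup_norm_on :: "'b set \<Rightarrow> ('b \<Rightarrow> complex) \<Rightarrow> real" where
  "sup_norm_on Q g = (SUP z\<in>Q. cmod (g z))"

definition polynomial_hull :: "(complex^'n) set \<Rightarrow> (complex^'n) set" where
  "polynomial_hull Q = {z. \<forall>q. complex_polynomial q \<longrightarrow> cmod (q z) \<le> sup_norm_on Q q}"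


section \<open>Random compact sets and generalized random functions\<close>

definition random_compact_set :: "'a measure \<Rightarrow> ('a \<Rightarrow> (complex^'n) set) \<Rightarrow> bool" where
  "random_compact_set M K \<longleftrightarrow> K \<in> M \<rightarrow>\<^sub>M hausdorff_borel"

definition fibre :: "'a measure \<Rightarrow> ('a \<Rightarrow> 'b set) \<Rightarrow> 'b \<Rightarrow> 'a set" where
  "fibre M K z = {\<omega> \<in> space M. z \<in> K \<omega>}"

text \<open>Functions on the graph of \<open>K\<close> are represented by total curried functions whose values off
  the graph are never used.\<close>

definition generalized_random_function ::
    "'a measure \<Rightarrow> ('a \<Rightarrow> (complex^'n) set) \<Rightarrow> ('a \<Rightarrow> complex^'n \<Rightarrow> complex) \<Rightarrow> bool" where
  "generalized_random_function M K f \<longleftrightarrow>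
     (\<forall>z. fibre M K z \<noteq> {} \<longrightarrow>
        (\<lambda>\<omega>. f \<omega> z) \<in> borel_measurable (restrict_space M (fibre M K z)))"

definition generalized_random_polynomial ::
    "'a measure \<Rightarrow> ('a \<Rightarrow> (complex^'n) set) \<Rightarrow> ('a \<Rightarrow> complex^'n \<Rightarrow> complex) \<Rightarrow> bool" where
  "generalized_random_polynomial M K p \<longleftrightarrow>
     generalized_random_function M K p \<and>
     (\<forall>\<omega>\<in>space M. \<exists>q. complex_polynomial q \<and> (\<forall>z\<in>K \<omega>. p \<omega> z = q z))"

end

theory Submission
  imports Defs "HOL-Complex_Analysis.Cauchy_Integral_Formula"
begin

text \<open>The range of \<open>K\<close> is countable, so \<open>\<Omega>\<close> splits into countably many measurable pieces on
  which \<open>K\<close> is a constant polynomially convex set \<open>Q\<close>. By the Oka--Weil theorem every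
  \<open>f(\<omega>, \<cdot>)\<close> is a uniform limit on \<open>Q\<close> of polynomials, and the coefficients may be taken in
  \<open>\<rat>(\<i>)\<close>. Enumerating these polynomials and taking for each \<open>\<omega>\<close> the first one within
  \<open>\<epsilon>(\<omega>)\<close> of \<open>f(\<omega>, \<cdot>)\<close> is a measurable choice, since a supremum over \<open>Q\<close> is a supremum over a
  countable dense subset.

  For Oka--Weil, \<open>Q\<close> is enclosed in a polyhedron \<open>|p\<^sub>j(z)| \<le> 1\<close> inside the domain of
  holomorphy, and \<open>z \<mapsto> (z, p(z))\<close> embeds it into a box as the graph \<open>w = p(z)\<close>. Following
  Oka, a holomorphic function near the graph extends, one equation at a time, to the box:
  extending across the hypersurface \<open>w\<^sub>j = p\<^sub>j(z)\<close> is a Cousin problem, which is solved on small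
  boxes and glued along common faces by splitting a Cauchy integral over a rectangle into two
  parts. The extension has a power series on a polydisc, and substituting \<open>w = p(z)\<close> in a
  partial sum gives the polynomial.\<close>

text \<open>Merging two solutions meets an obstacle: the quotient of their discrepancy is known only
  near \<open>gr K\<close> over the common face, whereas the Cauchy splitting needs a function near
  the whole face. So extension for fewer equations is used inside the Cousin problem as well as
  after it, and the induction hypothesis ranges over all functions and boxes. Points are first
  projected by \<open>proj K\<close>, which solves the other equations and leaves a division by a
  single one.

  The constants reconcile squares with discs. The polynomials are at most 1/2 on Q, and at each
  point of the enclosing cube outside the domain one of them exceeds 2. The square of half-side 1
  contains the unit disc and has only points of modulus at most 2, so the graph over the box stays
  in the domain, while the gap between the radii 1/2 and 1 makes the Taylor sums converge
  uniformly.\<close>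

section \<open>Holomorphic functions of countably many variables\<close>

text \<open>All variables live in the one type \<^typ>\<open>nat \<Rightarrow> complex\<close> with its product topology, so that
  the induction on the number of equations can add coordinates without changing the type.
  Continuity together with holomorphy in each variable is enough by Cauchy's formula (Osgood).\<close>

definition hol :: "((nat \<Rightarrow> complex) \<Rightarrow> complex) \<Rightarrow> (nat \<Rightarrow> complex) set \<Rightarrow> bool" where
  "hol F U \<longleftrightarrow> continuous_on U F \<and>
     (\<forall>x\<in>U. \<forall>i. (\<lambda>t. F (x(i := t))) field_differentiable at (x i))"

lemma continuous_on_fun_upd:
  fixes x :: "'b::topological_space \<Rightarrow> 'c \<Rightarrow> 'd::topological_space"
  assumes "continuous_on S x" "continuous_on S t"
  shows "continuous_on S (\<lambda>y. (x y)(i := t y))"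
proof (rule continuous_on_coordinatewise_then_product)
  fix k show "continuous_on S (\<lambda>y. ((x y)(i := t y)) k)"
    using assms by (cases "k = i") (auto intro: continuous_on_product_then_coordinatewise)
qed

lemma continuous_on_coordinate: "continuous_on S (\<lambda>x. x k :: 'd::topological_space)"
  by (rule continuous_on_subset[OF continuous_on_product_coordinates]) simp

lemma open_slice:
  assumes "open U" shows "open {t. x(i := t) \<in> U}"
proof -
  have "open ((\<lambda>t. x(i := t)) -` U)"
    by (intro open_vimage assms continuous_on_fun_upd continuous_on_const continuous_on_id)
  then show ?thesis by (simp add: vimage_def)
qed

lemma hol_subset: "hol F U \<Longrightarrow> V \<subseteq> U \<Longrightarrow> hol F V"
  by (auto simp: hol_def intro: continuous_on_subset)

lemma hol_slice:
  assumes "hol F U"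
  shows "(\<lambda>t. F (x(i := t))) holomorphic_on {t. x(i := t) \<in> U}"
proof (rule holomorphic_onI)
  fix t assume t: "t \<in> {t. x(i := t) \<in> U}"
  then have "(\<lambda>s. F ((x(i := t))(i := s))) field_differentiable at ((x(i := t)) i)"
    using assms unfolding hol_def by blast
  then show "(\<lambda>t. F (x(i := t))) field_differentiable (at t within {t. x(i := t) \<in> U})"
    by (simp add: field_differentiable_at_within)
qed

text \<open>The slice form is what Morera's theorem delivers; on an open slice it gives back
  differentiability at the point itself.\<close>

lemma hol_iff_slices:
  assumes "open U"
  shows "hol F U \<longleftrightarrow> continuous_on U F \<and>
     (\<forall>x i. (\<lambda>t. F (x(i := t))) holomorphic_on {t. x(i := t) \<in> U})"
proof
  assume "hol F U" then show "continuous_on U F \<and>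
     (\<forall>x i. (\<lambda>t. F (x(i := t))) holomorphic_on {t. x(i := t) \<in> U})"
    using hol_slice hol_def by blast
next
  assume *: "continuous_on U F \<and>
     (\<forall>x i. (\<lambda>t. F (x(i := t))) holomorphic_on {t. x(i := t) \<in> U})"
  show "hol F U" unfolding hol_def
  proof (intro conjI ballI allI)
    fix x i assume "x \<in> U"
    then have "x i \<in> {t. x(i := t) \<in> U}" by simp
    then show "(\<lambda>t. F (x(i := t))) field_differentiable at (x i)"
      using * open_slice[OF assms, of x i] holomorphic_on_imp_differentiable_at by blast
  qed (use * in blast)
qed

text \<open>One function may thus be represented near each point by a different formula, such as a
  Cauchy integral over a circle chosen there.\<close>

lemma hol_local:
  assumes "\<And>x. x \<in> U \<Longrightarrow> \<exists>V G. open V \<and> x \<in> V \<and> hol G V \<and> (\<forall>y\<in>V. F y = G y)"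
  shows "hol F U"
  unfolding hol_def
proof (intro conjI ballI allI)
  have "isCont F x" if "x \<in> U" for x
  proof -
    from assms[OF that] obtain V G where V: "open V" "x \<in> V" "hol G V" "\<forall>y\<in>V. F y = G y"
      by (elim exE conjE)
    then have "continuous_on V F" by (simp add: hol_def cong: continuous_on_cong_simp)
    then show ?thesis using V continuous_on_eq_continuous_at by blast
  qed
  then show "continuous_on U F" by (simp add: continuous_at_imp_continuous_on)
next
  fix x i assume "x \<in> U"
  from assms[OF this] obtain V G where V: "open V" "x \<in> V" "hol G V" "\<forall>y\<in>V. F y = G y"
    by (elim exE conjE)
  have "(\<lambda>t. G (x(i := t))) holomorphic_on {t. x(i := t) \<in> V}"
    by (rule hol_slice[OF V(3)])
  then have "(\<lambda>t. F (x(i := t))) holomorphic_on {t. x(i := t) \<in> V}"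
    by (rule holomorphic_transform) (use V in auto)
  then show "(\<lambda>t. F (x(i := t))) field_differentiable at (x i)"
    using open_slice[OF V(1), of x i] V(2) holomorphic_on_imp_differentiable_at by fastforce
qed

lemma hol_cong:
  assumes "open U" "hol G U" "\<And>y. y \<in> U \<Longrightarrow> F y = G y"
  shows "hol F U"
  using assms by (intro hol_local) blast

lemma hol_union:
  assumes "open U" "hol F U" "open V" "hol F V"
  shows "hol F (U \<union> V)"
  using assms by (intro hol_local) blast

lemma hol_const [simp]: "hol (\<lambda>x. c) U"
  by (auto simp: hol_def)

lemma hol_coord [simp]: "hol (\<lambda>x. x i) U"
  unfolding hol_def
proof (intro conjI ballI allI)
  fix x k show "(\<lambda>t. (x(k := t)) i) field_differentiable at (x k)"
    by (cases "i = k") auto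
qed (rule continuous_on_coordinate)

lemma hol_add: "hol F U \<Longrightarrow> hol G U \<Longrightarrow> hol (\<lambda>x. F x + G x) U"
  by (simp add: hol_def continuous_on_add field_differentiable_add)

lemma hol_diff: "hol F U \<Longrightarrow> hol G U \<Longrightarrow> hol (\<lambda>x. F x - G x) U"
  by (simp add: hol_def continuous_on_diff field_differentiable_diff)

lemma hol_mult: "hol F U \<Longrightarrow> hol G U \<Longrightarrow> hol (\<lambda>x. F x * G x) U"
  by (simp add: hol_def continuous_on_mult field_differentiable_mult)

lemma hol_divide:
  "hol F U \<Longrightarrow> hol G U \<Longrightarrow> (\<And>x. x \<in> U \<Longrightarrow> G x \<noteq> 0) \<Longrightarrow> hol (\<lambda>x. F x / G x) U"
  by (simp add: hol_def continuous_on_divide field_differentiable_divide)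

lemma hol_sum: "(\<And>i. i \<in> I \<Longrightarrow> hol (F i) U) \<Longrightarrow> hol (\<lambda>x. \<Sum>i\<in>I. F i x) U"
  by (induction I rule: infinite_finite_induct) (simp_all add: hol_add)

lemma hol_power: "hol F U \<Longrightarrow> hol (\<lambda>x. F x ^ n) U"
  by (induction n) (simp_all add: hol_mult)

lemma hol_upd_const:
  assumes "hol F U"
  shows "hol (\<lambda>x. F (x(j := w))) {x. x(j := w) \<in> U}"
  unfolding hol_def
proof (intro conjI ballI allI)
  have "continuous_on U F" using assms by (simp add: hol_def)
  then show "continuous_on {x. x(j := w) \<in> U} (\<lambda>x. F (x(j := w)))"
    by (rule continuous_on_compose2) (auto intro: continuous_on_fun_upd continuous_on_const continuous_on_id)
next
  fix x i assume x: "x \<in> {x. x(j := w) \<in> U}"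
  show "(\<lambda>t. F ((x(i := t))(j := w))) field_differentiable at (x i)"
  proof (cases "i = j")
    case False
    then have eq: "(x(i := t))(j := w) = (x(j := w))(i := t)" for t
      by (rule fun_upd_twist)
    have xi: "(x(j := w)) i = x i" using False by simp
    have "(\<lambda>t. F ((x(j := w))(i := t))) field_differentiable at ((x(j := w)) i)"
      using assms x unfolding hol_def by blast
    then show ?thesis unfolding eq xi .
  qed simp
qed

text \<open>A derivative continuous on the whole parameter interval makes the integrand jointly
  continuous, which both continuity in the parameter and the exchange of integrals use. Rectangle
  boundaries, which have corners, are treated one side at a time.\<close>

definition C1_path :: "(real \<Rightarrow> complex) \<Rightarrow> bool" where
  "C1_path \<gamma> \<longleftrightarrow> valid_path \<gamma> \<and> continuous_on {0..1} (\<lambda>t. vector_derivative \<gamma> (at t))"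

lemma C1_path_linepath [simp]: "C1_path (linepath a b)"
  by (auto simp: C1_path_def)

lemma C1_path_circlepath [simp]: "C1_path (circlepath z r)"
  by (auto simp: C1_path_def vector_derivative_circlepath intro!: continuous_intros)

text \<open>Morera's theorem in each variable, with the two integrations exchanged.\<close>

lemma hol_contour_integral:
  assumes U: "open U" and \<gamma>: "C1_path \<gamma>"
    and cont: "continuous_on (U \<times> path_image \<gamma>) (\<lambda>(x, \<zeta>). H x \<zeta>)"
    and hol: "\<And>\<zeta>. \<zeta> \<in> path_image \<gamma> \<Longrightarrow> hol (\<lambda>x. H x \<zeta>) U"
  shows "hol (\<lambda>x. contour_integral \<gamma> (H x)) U"
  unfolding hol_iff_slices[OF U]
proof (intro conjI allI)
  have cont': "continuous_on (U \<times> path_image \<gamma>) (\<lambda>p. H (fst p) (snd p))"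
    using cont by (simp add: case_prod_unfold)
  have pg: "\<gamma> t \<in> path_image \<gamma>" if "t \<in> cbox 0 1" for t
    using that by (auto simp: path_image_def)
  have cg: "continuous_on (cbox 0 1) \<gamma>"
    using \<gamma> by (auto simp: C1_path_def valid_path_def piecewise_C1_differentiable_on_def)
  have cd: "continuous_on (cbox 0 1) (\<lambda>t. vector_derivative \<gamma> (at t))"
    using \<gamma> by (auto simp: C1_path_def)
  have "continuous_on (U \<times> cbox 0 1) (\<lambda>(x, t). H x (\<gamma> t) * vector_derivative \<gamma> (at t))"
    unfolding case_prod_unfold
  proof (rule continuous_on_mult)
    show "continuous_on (U \<times> cbox 0 1) (\<lambda>p. H (fst p) (\<gamma> (snd p)))"
    proof (rule continuous_on_compose2[OF cont', of _ "\<lambda>p. (fst p, \<gamma> (snd p))", unfolded fst_conv snd_conv])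
      show "continuous_on (U \<times> cbox 0 1) (\<lambda>p. (fst p, \<gamma> (snd p)))"
        by (intro continuous_on_Pair continuous_on_compose2[OF cg])
          (auto intro: continuous_on_fst continuous_on_snd continuous_on_id)
    qed (use pg in auto)
    show "continuous_on (U \<times> cbox 0 1) (\<lambda>p. vector_derivative \<gamma> (at (snd p)))"
      by (rule continuous_on_compose2[OF cd]) (auto intro!: continuous_intros)
  qed
  then have "continuous_on U (\<lambda>x. integral (cbox 0 1) (\<lambda>t. H x (\<gamma> t) * vector_derivative \<gamma> (at t)))"
    by (rule integral_continuous_on_param)
  then show c: "continuous_on U (\<lambda>x. contour_integral \<gamma> (H x))"
    by (simp add: contour_integral_integral)
  fix x i
  let ?S = "{t. x(i := t) \<in> U}"
  have S: "open ?S" by (rule open_slice[OF U])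
  have "(\<lambda>t. contour_integral \<gamma> (H (x(i := t)))) analytic_on ?S"
  proof (rule Morera_triangle[OF _ S], safe)
    show "continuous_on ?S (\<lambda>t. contour_integral \<gamma> (H (x(i := t))))"
      by (rule continuous_on_compose2[OF c])
        (auto intro: continuous_on_fun_upd continuous_on_const continuous_on_id)
  next
    fix a b c assume abc: "convex hull {a, b, c} \<subseteq> ?S"
    have sw: "contour_integral (linepath u v) (\<lambda>t. contour_integral \<gamma> (H (x(i := t)))) =
       contour_integral \<gamma> (\<lambda>\<zeta>. contour_integral (linepath u v) (\<lambda>t. H (x(i := t)) \<zeta>))"
      and int: "(\<lambda>\<zeta>. contour_integral (linepath u v) (\<lambda>t. H (x(i := t)) \<zeta>)) contour_integrable_on \<gamma>"
      if "u \<in> {a,b,c}" "v \<in> {a,b,c}" for u v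
    proof -
      have seg: "closed_segment u v \<subseteq> ?S"
        using abc that by (meson closed_segment_subset_convex_hull hull_inc subset_trans)
      have cc: "continuous_on (closed_segment u v \<times> path_image \<gamma>) (\<lambda>(t, \<zeta>). H (x(i := t)) \<zeta>)"
        unfolding case_prod_unfold
        by (rule continuous_on_compose2[OF cont', of _ "\<lambda>p. (x(i := fst p), snd p)", unfolded fst_conv snd_conv])
           (use seg in \<open>auto intro!: continuous_on_Pair continuous_on_fun_upd continuous_on_const continuous_on_fst continuous_on_snd continuous_on_id\<close>)
      then show "contour_integral (linepath u v) (\<lambda>t. contour_integral \<gamma> (H (x(i := t)))) =
       contour_integral \<gamma> (\<lambda>\<zeta>. contour_integral (linepath u v) (\<lambda>t. H (x(i := t)) \<zeta>))"
        using \<gamma> by (intro contour_integral_swap) (auto simp: C1_path_def)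
      \<comment> \<open>Integrability of the inner integrals along \<gamma> lets the three sides of
        the triangle be added under one outer integral.\<close>
      have "continuous_on (path_image \<gamma>) (\<lambda>\<zeta>. integral (cbox 0 1)
              (\<lambda>s. H (x(i := linepath u v s)) \<zeta> * vector_derivative (linepath u v) (at s)))"
      proof (rule integral_continuous_on_param)
        show "continuous_on (path_image \<gamma> \<times> cbox 0 1)
           (\<lambda>(\<zeta>, s). H (x(i := linepath u v s)) \<zeta> * vector_derivative (linepath u v) (at s))"
          unfolding case_prod_unfold
        proof (intro continuous_on_mult)
          show "continuous_on (path_image \<gamma> \<times> cbox 0 1)
             (\<lambda>p. H (x(i := linepath u v (snd p))) (fst p))"
            by (rule continuous_on_compose2[OF cc[unfolded case_prod_unfold], of _ "\<lambda>p. (linepath u v (snd p), fst p)", unfolded fst_conv snd_conv])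
               (auto simp: linepath_def closed_segment_def intro!: continuous_intros)
        qed (auto intro!: continuous_intros)
      qed
      then have *: "continuous_on (path_image \<gamma>) (\<lambda>\<zeta>. contour_integral (linepath u v) (\<lambda>t. H (x(i := t)) \<zeta>))"
        by (simp add: contour_integral_integral)
      have "continuous_on (cbox 0 1) (\<lambda>t. contour_integral (linepath u v) (\<lambda>s. H (x(i := s)) (\<gamma> t)) *
          vector_derivative \<gamma> (at t))"
        by (rule continuous_on_mult[OF continuous_on_compose2[OF * cg] cd]) (use pg in auto)
      then show "(\<lambda>\<zeta>. contour_integral (linepath u v) (\<lambda>t. H (x(i := t)) \<zeta>)) contour_integrable_on \<gamma>"
        unfolding contour_integrable_on using integrable_continuous by fastforce
    qed
    have zero: "contour_integral (linepath a b) (\<lambda>t. H (x(i := t)) \<zeta>) +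
          contour_integral (linepath b c) (\<lambda>t. H (x(i := t)) \<zeta>) +
          contour_integral (linepath c a) (\<lambda>t. H (x(i := t)) \<zeta>) = 0"
      if z: "\<zeta> \<in> path_image \<gamma>" for \<zeta>
    proof -
      have h: "(\<lambda>t. H (x(i := t)) \<zeta>) holomorphic_on convex hull {a,b,c}"
        using hol_slice[OF hol[OF z]] abc by (meson holomorphic_on_subset)
      from Cauchy_theorem_triangle[OF h]
      have *: "((\<lambda>t. H (x(i := t)) \<zeta>) has_contour_integral 0) (linepath a b +++ linepath b c +++ linepath c a)" .
      show ?thesis
        using has_chain_integral_chain_integral3[OF *] by simp
    qed
    have "contour_integral (linepath a b) (\<lambda>t. contour_integral \<gamma> (H (x(i := t)))) +
          contour_integral (linepath b c) (\<lambda>t. contour_integral \<gamma> (H (x(i := t)))) +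
          contour_integral (linepath c a) (\<lambda>t. contour_integral \<gamma> (H (x(i := t)))) =
       contour_integral \<gamma> (\<lambda>\<zeta>. contour_integral (linepath a b) (\<lambda>t. H (x(i := t)) \<zeta>) +
          contour_integral (linepath b c) (\<lambda>t. H (x(i := t)) \<zeta>) +
          contour_integral (linepath c a) (\<lambda>t. H (x(i := t)) \<zeta>))"
      by (simp add: sw contour_integral_add contour_integrable_add int)
    also have "\<dots> = contour_integral \<gamma> (\<lambda>\<zeta>. 0)"
      by (rule contour_integral_eq) (use zero in auto)
    finally show "contour_integral (linepath a b) (\<lambda>t. contour_integral \<gamma> (H (x(i := t)))) +
          contour_integral (linepath b c) (\<lambda>t. contour_integral \<gamma> (H (x(i := t)))) +
          contour_integral (linepath c a) (\<lambda>t. contour_integral \<gamma> (H (x(i := t)))) = 0"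
      by simp
  qed
  then show "(\<lambda>t. contour_integral \<gamma> (H (x(i := t)))) holomorphic_on ?S"
    by (simp add: analytic_imp_holomorphic)
qed

section \<open>Substitution and division along a graph\<close>

lemma continuous_on_upd_fst_snd: "continuous_on S (\<lambda>p. (fst p)(j := snd p))"
  by (intro continuous_on_fun_upd continuous_on_fst continuous_on_snd continuous_on_id)

lemma continuous_on_upd_pair:
  assumes "continuous_on U F" "\<And>x \<zeta>. x \<in> X \<Longrightarrow> \<zeta> \<in> S \<Longrightarrow> x(j := \<zeta>) \<in> U"
  shows "continuous_on (X \<times> S) (\<lambda>p. F ((fst p)(j := snd p)))"
  by (rule continuous_on_compose2[OF assms(1) continuous_on_upd_fst_snd]) (use assms(2) in auto)

lemma open_upd:
  assumes "open U" "continuous_on UNIV p"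
  shows "open {x. x(j := p x) \<in> U}"
proof -
  have "open ((\<lambda>x. x(j := p x)) -` U)"
    by (intro open_vimage assms continuous_on_fun_upd continuous_on_id)
  then show ?thesis by (simp add: vimage_def)
qed

text \<open>A product neighbourhood provides one circle that serves for all nearby x, so that the
  Cauchy integral has a fixed contour.\<close>

lemma upd_neighbourhood:
  fixes x0 :: "nat \<Rightarrow> complex"
  assumes "open U" "x0(j := w) \<in> U"
  obtains X r where "open X" "x0 \<in> X" "0 < r"
    "\<And>x \<zeta>. x \<in> X \<Longrightarrow> \<zeta> \<in> cball w r \<Longrightarrow> x(j := \<zeta>) \<in> U"
proof -
  have "open ((\<lambda>p. (fst p)(j := snd p)) -` U)"
    by (intro open_vimage assms continuous_on_upd_fst_snd)
  moreover have "(x0, w) \<in> (\<lambda>p. (fst p)(j := snd p)) -` U" using assms by simp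
  ultimately obtain X Y where XY: "open X" "open Y" "x0 \<in> X" "w \<in> Y"
    "X \<times> Y \<subseteq> (\<lambda>p. (fst p)(j := snd p)) -` U"
    by (elim open_prod_elim) auto
  obtain r where "r > 0" "cball w r \<subseteq> Y" using XY open_contains_cball by blast
  then show ?thesis using XY that[of X r] by fastforce
qed

text \<open>Locally \<open>F (x(j := p x))\<close> is the Cauchy integral of \<open>F (x(j := \<zeta>)) / (\<zeta> - p x)\<close> over a fixed
  circle, which avoids a chain rule in several variables.\<close>

lemma hol_substitute:
  assumes U: "open U" and F: "hol F U" and p: "hol p UNIV"
  shows "hol (\<lambda>x. F (x(j := p x))) {x. x(j := p x) \<in> U}"
proof (rule hol_local)
  have pc: "continuous_on UNIV p" using p by (simp add: hol_def)
  have Fc: "continuous_on U F" using F by (simp add: hol_def)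
  fix x0 assume x0: "x0 \<in> {x. x(j := p x) \<in> U}"
  then obtain X r where X: "open X" "x0 \<in> X" "0 < r"
    and XU: "\<And>x \<zeta>. x \<in> X \<Longrightarrow> \<zeta> \<in> cball (p x0) r \<Longrightarrow> x(j := \<zeta>) \<in> U"
    using upd_neighbourhood[OF U, of x0 j "p x0"] by blast
  \<comment> \<open>On Y the value \<open>p x\<close> stays strictly inside the circle: the kernel
    has no pole on the contour and Cauchy's formula applies.\<close>
  define Y where "Y = X \<inter> p -` ball (p x0) r"
  have Y: "open Y" "x0 \<in> Y"
    unfolding Y_def using X open_vimage[OF open_ball pc] by auto
  have ne: "\<zeta> \<noteq> p x" if "x \<in> Y" "\<zeta> \<in> sphere (p x0) r" for x \<zeta>
    using that by (auto simp: Y_def)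
  let ?I = "\<lambda>x. contour_integral (circlepath (p x0) r) (\<lambda>\<zeta>. F (x(j := \<zeta>)) / (\<zeta> - p x))"
  have sph: "path_image (circlepath (p x0) r) = sphere (p x0) r" using X by simp
  have "hol ?I Y"
  proof (rule hol_contour_integral[OF Y(1) C1_path_circlepath], unfold sph)
    have "continuous_on (Y \<times> sphere (p x0) r) (\<lambda>q. F ((fst q)(j := snd q)))"
      by (rule continuous_on_upd_pair[OF Fc]) (use XU in \<open>auto simp: Y_def\<close>)
    moreover have "continuous_on (Y \<times> sphere (p x0) r) (\<lambda>q. snd q - p (fst q))"
      by (intro continuous_on_diff continuous_on_snd continuous_on_id
          continuous_on_compose2[OF pc continuous_on_fst]) auto
    ultimately show "continuous_on (Y \<times> sphere (p x0) r) (\<lambda>(x, \<zeta>). F (x(j := \<zeta>)) / (\<zeta> - p x))"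
      unfolding case_prod_unfold by (rule continuous_on_divide) (use ne in auto)
  next
    fix \<zeta> assume z: "\<zeta> \<in> sphere (p x0) r"
    have "hol (\<lambda>x. F (x(j := \<zeta>))) Y"
      by (rule hol_subset[OF hol_upd_const[OF F]]) (use XU z in \<open>auto simp: Y_def\<close>)
    moreover have "hol (\<lambda>x. \<zeta> - p x) Y" by (intro hol_diff hol_const hol_subset[OF p]) auto
    ultimately show "hol (\<lambda>x. F (x(j := \<zeta>)) / (\<zeta> - p x)) Y"
      by (rule hol_divide) (use ne z in auto)
  qed
  then have "hol (\<lambda>x. ?I x / (2 * of_real pi * \<i>)) Y"
    by (rule hol_divide) auto
  moreover have "F (x(j := p x)) = ?I x / (2 * of_real pi * \<i>)" if x: "x \<in> Y" for x
  proof -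
    have "(\<lambda>t. F (x(j := t))) holomorphic_on cball (p x0) r"
      by (rule holomorphic_on_subset[OF hol_slice[OF F]]) (use XU x in \<open>auto simp: Y_def\<close>)
    moreover have "cmod (p x - p x0) < r" using x by (auto simp: Y_def dist_norm norm_minus_commute)
    ultimately have "?I x = 2 * of_real pi * \<i> * F (x(j := p x))"
      using Cauchy_integral_circlepath_simple contour_integral_unique by blast
    then show ?thesis by simp
  qed
  ultimately show "\<exists>V G. open V \<and> x0 \<in> V \<and> hol G V \<and> (\<forall>y\<in>V. F (y(j := p y)) = G y)"
    using Y by blast
qed

text \<open>With a = \<open>x j\<close> and b = \<open>p x\<close> it turns the difference of two
  Cauchy formulas into a single integral whose kernel stays regular when a and b coincide.\<close>

lemma partial_fraction:
  fixes h u a b :: "'a::field"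
  assumes "u \<noteq> a" "u \<noteq> b" "a \<noteq> b"
  shows "(h / (u - a) - h / (u - b)) / (a - b) = h / ((u - a) * (u - b))"
proof -
  have "h / (u - a) - h / (u - b) = h * (a - b) / ((u - a) * (u - b))"
    using assms by (simp add: diff_frac_eq algebra_simps)
  then show ?thesis using assms by simp
qed

text \<open>Near a zero of \<open>x j - p x\<close> the quotient is the Cauchy integral of
  \<open>H (x(j := \<zeta>)) / ((\<zeta> - x j) * (\<zeta> - p x))\<close>.\<close>

lemma hol_divide_graph:
  assumes W: "open W" and H: "hol H W" and p: "hol p UNIV"
    and pj: "\<And>x t. p (x(j := t)) = p x"
    and zero: "\<And>x. x \<in> W \<Longrightarrow> x j = p x \<Longrightarrow> H x = 0"
  obtains h where "hol h W" "\<And>x. x \<in> W \<Longrightarrow> H x = (x j - p x) * h x"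
proof
  \<comment> \<open>On the zero set the quotient takes its limit in direction j, which is the
    partial derivative because \<open>p x\<close> does not vary with \<open>x j\<close>.\<close>
  let ?h = "\<lambda>x. if x j = p x then deriv (\<lambda>t. H (x(j := t))) (x j) else H x / (x j - p x)"
  show "\<And>x. x \<in> W \<Longrightarrow> H x = (x j - p x) * ?h x" using zero by auto
  have pc: "continuous_on UNIV p" using p by (simp add: hol_def)
  have Hc: "continuous_on W H" using H by (simp add: hol_def)
  have jc: "continuous_on UNIV (\<lambda>x. x j - p x)"
    by (intro continuous_on_diff pc continuous_on_coordinate)
  show "hol ?h W"
  proof (rule hol_local)
    fix x0 assume x0: "x0 \<in> W"
    show "\<exists>V G. open V \<and> x0 \<in> V \<and> hol G V \<and> (\<forall>y\<in>V. ?h y = G y)"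
    proof (cases "x0 j = p x0")
      case False
      define V where "V = W \<inter> (\<lambda>x. x j - p x) -` (- {0})"
      have "open V" unfolding V_def by (intro open_Int W open_vimage jc) auto
      moreover have "x0 \<in> V" using x0 False by (auto simp: V_def)
      moreover have "hol (\<lambda>x. H x / (x j - p x)) V"
        by (intro hol_divide hol_subset[OF H] hol_diff hol_coord hol_subset[OF p]) (auto simp: V_def)
      moreover have "\<forall>y\<in>V. ?h y = H y / (y j - p y)" by (auto simp: V_def)
      ultimately show ?thesis by blast
    next
      case True
      then have "x0(j := p x0) = x0" by (metis fun_upd_triv)
      then obtain X r where X: "open X" "x0 \<in> X" "0 < r"
        and XW: "\<And>x \<zeta>. x \<in> X \<Longrightarrow> \<zeta> \<in> cball (p x0) r \<Longrightarrow> x(j := \<zeta>) \<in> W"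
        using upd_neighbourhood[OF W, of x0 j "p x0"] x0 by auto
      define Y where "Y = X \<inter> (p -` ball (p x0) r \<inter> (\<lambda>x. x j) -` ball (p x0) r)"
      have Y: "open Y"
        unfolding Y_def by (intro open_Int X open_vimage pc continuous_on_coordinate) auto
      have x0Y: "x0 \<in> Y" using X True by (auto simp: Y_def)
      have ne: "\<zeta> \<noteq> p x" "\<zeta> \<noteq> x j" if "x \<in> Y" "\<zeta> \<in> sphere (p x0) r" for x \<zeta>
        using that by (auto simp: Y_def)
      let ?I = "\<lambda>x. contour_integral (circlepath (p x0) r) (\<lambda>\<zeta>. H (x(j := \<zeta>)) / ((\<zeta> - x j) * (\<zeta> - p x)))"
      have sph: "path_image (circlepath (p x0) r) = sphere (p x0) r" using X by simp
      have "hol ?I Y"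
      proof (rule hol_contour_integral[OF Y(1) C1_path_circlepath], unfold sph)
        have "continuous_on (Y \<times> sphere (p x0) r) (\<lambda>q. H ((fst q)(j := snd q)))"
          by (rule continuous_on_upd_pair[OF Hc]) (use XW in \<open>auto simp: Y_def\<close>)
        moreover have "continuous_on (Y \<times> sphere (p x0) r) (\<lambda>q. (snd q - fst q j) * (snd q - p (fst q)))"
          by (intro continuous_on_mult continuous_on_diff continuous_on_snd continuous_on_id
              continuous_on_compose2[OF continuous_on_coordinate[of UNIV j] continuous_on_fst]
              continuous_on_compose2[OF pc continuous_on_fst]) auto
        ultimately show "continuous_on (Y \<times> sphere (p x0) r)
            (\<lambda>(x, \<zeta>). H (x(j := \<zeta>)) / ((\<zeta> - x j) * (\<zeta> - p x)))"
          unfolding case_prod_unfold by (rule continuous_on_divide) (use ne in auto)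
      next
        fix \<zeta> assume z: "\<zeta> \<in> sphere (p x0) r"
        have "hol (\<lambda>x. H (x(j := \<zeta>))) Y"
          by (rule hol_subset[OF hol_upd_const[OF H]]) (use XW z in \<open>auto simp: Y_def\<close>)
        moreover have "hol (\<lambda>x. (\<zeta> - x j) * (\<zeta> - p x)) Y"
          by (intro hol_mult hol_diff hol_const hol_coord hol_subset[OF p]) auto
        ultimately show "hol (\<lambda>x. H (x(j := \<zeta>)) / ((\<zeta> - x j) * (\<zeta> - p x))) Y"
          by (rule hol_divide) (use ne z in auto)
      qed
      then have "hol (\<lambda>x. ?I x / (2 * of_real pi * \<i>)) Y"
        by (rule hol_divide) auto
      moreover have "?h x = ?I x / (2 * of_real pi * \<i>)" if x: "x \<in> Y" for x
      proof -
        have hs: "(\<lambda>t. H (x(j := t))) holomorphic_on cball (p x0) r"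
          by (rule holomorphic_on_subset[OF hol_slice[OF H]]) (use XW x in \<open>auto simp: Y_def\<close>)
        have n: "cmod (p x - p x0) < r" "cmod (x j - p x0) < r"
          using x by (auto simp: Y_def dist_norm norm_minus_commute)
        show ?thesis
        proof (cases "x j = p x")
          case True
          have "deriv (\<lambda>t. H (x(j := t))) (x j) = 1 / (2 * of_real pi * \<i>) *
              contour_integral (circlepath (p x0) r) (\<lambda>u. H (x(j := u)) / (u - x j)^2)"
            using Cauchy_derivative_integral_circlepath(2)[of "p x0" r "\<lambda>t. H (x(j := t))" "x j"] n hs
            by (auto intro!: DERIV_imp_deriv simp: holomorphic_on_imp_continuous_on holomorphic_on_subset[OF hs ball_subset_cball] dist_norm norm_minus_commute)
          then show ?thesis using True by (simp add: power2_eq_square)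
        next
          case False
          have xW: "x(j := p x) \<in> W" using XW x by (auto simp: Y_def)
          \<comment> \<open>One of the two Cauchy values vanishes, since \<open>x(j := p x)\<close>
            lies on the zero set; what remains is \<open>H x / (x j - p x)\<close>.\<close>
          have "H (x(j := p x)) = 0" using zero[OF xW] pj by simp
          moreover have "((\<lambda>u. H (x(j := u)) / (u - x j)) has_contour_integral (2 * of_real pi * \<i> * H (x(j := x j)))) (circlepath (p x0) r)"
            "((\<lambda>u. H (x(j := u)) / (u - p x)) has_contour_integral (2 * of_real pi * \<i> * H (x(j := p x)))) (circlepath (p x0) r)"
            using Cauchy_integral_circlepath_simple[OF hs] n by blast+
          ultimately have "((\<lambda>u. (H (x(j := u)) / (u - x j) - H (x(j := u)) / (u - p x)) / (x j - p x)) has_contour_integral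
              (2 * of_real pi * \<i> * H x - 0) / (x j - p x)) (circlepath (p x0) r)"
            by (intro has_contour_integral_div has_contour_integral_diff) auto
          then have "((\<lambda>\<zeta>. H (x(j := \<zeta>)) / ((\<zeta> - x j) * (\<zeta> - p x))) has_contour_integral
              (2 * of_real pi * \<i> * H x - 0) / (x j - p x)) (circlepath (p x0) r)"
          proof (rule has_contour_integral_eq)
            fix u assume "u \<in> path_image (circlepath (p x0) r)"
            then have "u \<in> sphere (p x0) r" by (simp only: sph)
            from ne[OF x this] show "(H (x(j := u)) / (u - x j) - H (x(j := u)) / (u - p x)) / (x j - p x) =
                H (x(j := u)) / ((u - x j) * (u - p x))"
              using False by (intro partial_fraction) auto
          qed
          then show ?thesis using False by (simp add: contour_integral_unique)
        qed
      qed
      ultimately show ?thesis using Y x0Y by blast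
    qed
  qed
qed

section \<open>Cousin splitting on boxes\<close>

definition Box :: "(nat \<Rightarrow> complex) \<Rightarrow> (nat \<Rightarrow> complex) \<Rightarrow> (nat \<Rightarrow> complex) set" where
  "Box a b = {x. \<forall>i. x i \<in> cbox (a i) (b i)}"

lemma compact_Box: "compact (Box a b)"
proof -
  have "Box a b = PiE UNIV (\<lambda>i. cbox (a i) (b i))"
    by (auto simp: Box_def PiE_def)
  then have "compactin (product_topology (\<lambda>i. euclidean) UNIV) (Box a b)"
    by (simp add: compactin_PiE)
  then show ?thesis by (simp add: euclidean_product_topology)
qed

lemma Box_upd: "x \<in> Box a b \<Longrightarrow> t \<in> cbox (a i) (b i) \<Longrightarrow> x(i := t) \<in> Box a b"
  by (auto simp: Box_def)

lemma cbox_complex_ne_iff: "cbox \<alpha> \<beta> \<noteq> {} \<longleftrightarrow> Re \<alpha> \<le> Re \<beta> \<and> Im \<alpha> \<le> Im \<beta>"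
  by (auto simp: box_ne_empty Basis_complex_def)

text \<open>Clamping z to the rectangle moves each real coordinate by at most \<delta>; the factor 2
  comes from bounding the modulus by the sum of both.\<close>

lemma cbox_near_point:
  fixes \<alpha> \<beta> z :: complex
  assumes "cbox \<alpha> \<beta> \<noteq> {}" "0 \<le> \<delta>" "z \<in> cbox (\<alpha> - Complex \<delta> \<delta>) (\<beta> + Complex \<delta> \<delta>)"
  obtains w where "w \<in> cbox \<alpha> \<beta>" "dist w z \<le> 2 * \<delta>"
proof
  have ne: "Re \<alpha> \<le> Re \<beta>" "Im \<alpha> \<le> Im \<beta>"
    using assms(1) by (auto simp: cbox_complex_ne_iff)
  let ?w = "Complex (max (Re \<alpha>) (min (Re \<beta>) (Re z))) (max (Im \<alpha>) (min (Im \<beta>) (Im z)))"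
  show "?w \<in> cbox \<alpha> \<beta>" using ne by (auto simp: in_cbox_complex_iff)
  have "dist ?w z \<le> \<bar>Re (?w - z)\<bar> + \<bar>Im (?w - z)\<bar>"
    unfolding dist_norm by (rule cmod_le)
  also have "\<dots> \<le> \<delta> + \<delta>"
    using assms(2,3) ne by (intro add_mono) (auto simp: in_cbox_complex_iff max_def min_def)
  finally show "dist ?w z \<le> 2 * \<delta>" by simp
qed

text \<open>The tube lemma yields a single \<delta> for all points near the box. That X ignores
  coordinate i matters later: Cauchy integrals in that coordinate are then defined at points whose
  own i-th coordinate is far from the rectangle.\<close>

lemma Box_tube:
  assumes U: "open U" "Box a b \<subseteq> U" and ne: "cbox (a i) (b i) \<noteq> {}"
  obtains X \<delta> where "open X" "Box a b \<subseteq> X" "0 < \<delta>" "\<And>x t. x \<in> X \<Longrightarrow> x(i := t) \<in> X"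
    "\<And>x \<zeta>. x \<in> X \<Longrightarrow> \<zeta> \<in> cbox (a i - Complex \<delta> \<delta>) (b i + Complex \<delta> \<delta>) \<Longrightarrow> x(i := \<zeta>) \<in> U"
proof -
  let ?W = "(\<lambda>p. (fst p)(i := snd p)) -` U"
  have "open ?W" by (intro open_vimage U continuous_on_upd_fst_snd)
  moreover have "Box a b \<times> cbox (a i) (b i) \<subseteq> ?W"
    using U Box_upd by fastforce
  ultimately obtain X Y where XY: "open X" "open Y" "Box a b \<subseteq> X" "cbox (a i) (b i) \<subseteq> Y" "X \<times> Y \<subseteq> ?W"
    using Wallace_theorem_prod_topology[of euclidean "Box a b" euclidean "cbox (a i) (b i)" ?W]
    by (auto simp: compact_Box)
  obtain \<epsilon> where e: "\<epsilon> > 0" "(\<Union>x\<in>cbox (a i) (b i). cball x \<epsilon>) \<subseteq> Y"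
    using compact_subset_open_imp_cball_epsilon_subset[of "cbox (a i) (b i)" Y] XY by auto
  show ?thesis
  proof
    \<comment> \<open>Testing membership at the fixed value \<open>a i\<close> makes the
      neighbourhood independent of coordinate i.\<close>
    show "open {x. x(i := a i) \<in> X}"
      by (rule open_upd[OF XY(1)]) simp
    show "Box a b \<subseteq> {x. x(i := a i) \<in> X}"
    proof
      fix x assume "x \<in> Box a b"
      then have "x(i := a i) \<in> Box a b"
        by (rule Box_upd) (use ne in \<open>simp add: cbox_complex_ne_iff in_cbox_complex_iff\<close>)
      then show "x \<in> {x. x(i := a i) \<in> X}" using XY(3) by blast
    qed
    show "0 < \<epsilon> / 2" using e by simp
    show "x(i := t) \<in> {x. x(i := a i) \<in> X}" if "x \<in> {x. x(i := a i) \<in> X}" for x t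
      using that by simp
    fix x \<zeta> assume x: "x \<in> {x. x(i := a i) \<in> X}"
      and z: "\<zeta> \<in> cbox (a i - Complex (\<epsilon> / 2) (\<epsilon> / 2)) (b i + Complex (\<epsilon> / 2) (\<epsilon> / 2))"
    obtain w where w: "w \<in> cbox (a i) (b i)" "dist w \<zeta> \<le> 2 * (\<epsilon> / 2)"
      by (rule cbox_near_point[OF ne _ z]) (use e in auto)
    then have "\<zeta> \<in> Y" using e by fastforce
    then have "(x(i := a i), \<zeta>) \<in> X \<times> Y" using x by simp
    then have "(x(i := a i), \<zeta>) \<in> ?W" using XY(5) by blast
    then show "x(i := \<zeta>) \<in> U" by simp
  qed
qed

text \<open>Boxes are cut along one real direction at a time, and s selects it: \<open>True\<close>
  for the real, \<open>False\<close> for the imaginary direction of a coordinate.\<close>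

definition set_part :: "bool \<Rightarrow> complex \<Rightarrow> real \<Rightarrow> complex" where
  "set_part s z u = (if s then Complex u (Im z) else Complex (Re z) u)"

definition part :: "bool \<Rightarrow> complex \<Rightarrow> real" where
  "part s z = (if s then Re z else Im z)"

text \<open>The contribution of one side of a contour can be singular only on that side, so it
  continues holomorphically across the rest of the rectangle boundary. This is the source of the
  splitting.\<close>

lemma hol_segment_integral:
  assumes G: "hol G U" and X: "open X"
    and XU: "\<And>x \<zeta>. x \<in> X \<Longrightarrow> \<zeta> \<in> closed_segment u v \<Longrightarrow> x(i := \<zeta>) \<in> U"
  shows "hol (\<lambda>x. contour_integral (linepath u v) (\<lambda>\<zeta>. G (x(i := \<zeta>)) / (\<zeta> - x i)))
           (X \<inter> (\<lambda>x. x i) -` (- closed_segment u v))"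
    and "open (X \<inter> (\<lambda>x. x i) -` (- closed_segment u v))"
proof -
  let ?Y = "X \<inter> (\<lambda>x. x i) -` (- closed_segment u v)"
  show Y: "open ?Y"
    by (intro open_Int X open_vimage open_Compl closed_segment continuous_on_coordinate)
  have Gc: "continuous_on U G" using G by (simp add: hol_def)
  show "hol (\<lambda>x. contour_integral (linepath u v) (\<lambda>\<zeta>. G (x(i := \<zeta>)) / (\<zeta> - x i))) ?Y"
  proof (rule hol_contour_integral[OF Y C1_path_linepath], unfold path_image_linepath)
    have "continuous_on (?Y \<times> closed_segment u v) (\<lambda>q. G ((fst q)(i := snd q)))"
      by (rule continuous_on_upd_pair[OF Gc]) (use XU in auto)
    moreover have "continuous_on (?Y \<times> closed_segment u v) (\<lambda>q. snd q - fst q i)"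
      by (intro continuous_on_diff continuous_on_snd continuous_on_id
          continuous_on_compose2[OF continuous_on_coordinate[of UNIV i] continuous_on_fst]) auto
    ultimately show "continuous_on (?Y \<times> closed_segment u v) (\<lambda>(x, \<zeta>). G (x(i := \<zeta>)) / (\<zeta> - x i))"
      unfolding case_prod_unfold by (rule continuous_on_divide) auto
  next
    fix \<zeta> assume z: "\<zeta> \<in> closed_segment u v"
    have "hol (\<lambda>x. G (x(i := \<zeta>))) ?Y"
      by (rule hol_subset[OF hol_upd_const[OF G]]) (use XU z in auto)
    moreover have "hol (\<lambda>x. \<zeta> - x i) ?Y" by (intro hol_diff hol_const hol_coord)
    ultimately show "hol (\<lambda>x. G (x(i := \<zeta>)) / (\<zeta> - x i)) ?Y"
      by (rule hol_divide) (use z in auto)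
  qed
qed

text \<open>Cauchy's formula over the boundary of a rectangle slightly larger than the common face: the
  side that cuts the first box gives \<open>G2\<close>, the other three, which avoid it, give \<open>G1\<close>.\<close>

lemma cousin_split:
  assumes U: "open U" "hol G U"
    and ne: "\<And>k. cbox (a k) (b k) \<noteq> {}"
    and c: "part s (a i) \<le> c" "c \<le> part s (b i)"
    and BU: "Box (a(i := set_part s (a i) c)) (b(i := set_part s (b i) c)) \<subseteq> U"
  obtains G1 N1 G2 N2 N where "open N1" "hol G1 N1" "Box a (b(i := set_part s (b i) c)) \<subseteq> N1"
    "open N2" "hol G2 N2" "Box (a(i := set_part s (a i) c)) b \<subseteq> N2"
    "open N" "Box (a(i := set_part s (a i) c)) (b(i := set_part s (b i) c)) \<subseteq> N"
    "\<And>x. x \<in> N \<Longrightarrow> G x = G1 x - G2 x"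
proof -
  \<comment> \<open>Corners of the i-th side of the common face, which is flat in the cut
    direction.\<close>
  define \<alpha> \<beta> where "\<alpha> = set_part s (a i) c" and "\<beta> = set_part s (b i) c"
  note ab = \<alpha>_def \<beta>_def
  have neR: "Re (a i) \<le> Re (b i)" "Im (a i) \<le> Im (b i)"
    using ne[of i] by (auto simp: cbox_complex_ne_iff)
  have ne': "cbox ((a(i := \<alpha>)) i) ((b(i := \<beta>)) i) \<noteq> {}"
    using neR c by (auto simp: ab set_part_def cbox_complex_ne_iff)
  let ?B = "Box (a(i := \<alpha>)) (b(i := \<beta>))"
  obtain X \<delta> where X: "open X" "?B \<subseteq> X" "0 < \<delta>" "\<And>x t. x \<in> X \<Longrightarrow> x(i := t) \<in> X"
    and XU: "\<And>x \<zeta>. x \<in> X \<Longrightarrow> \<zeta> \<in> cbox (\<alpha> - Complex \<delta> \<delta>) (\<beta> + Complex \<delta> \<delta>) \<Longrightarrow> x(i := \<zeta>) \<in> U"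
    using Box_tube[OF U(1) BU[folded ab] ne'] by (auto simp del: fun_upd_apply simp: fun_upd_same)
  define A C where "A = \<alpha> - Complex \<delta> \<delta>" and "C = \<beta> + Complex \<delta> \<delta>"
  define A2 A4 where "A2 = Complex (Re C) (Im A)" and "A4 = Complex (Re A) (Im C)"
  have le: "Re \<alpha> \<le> Re \<beta>" "Im \<alpha> \<le> Im \<beta>" using ne' by (auto simp: cbox_complex_ne_iff)
  have reim: "Re A = Re \<alpha> - \<delta>" "Im A = Im \<alpha> - \<delta>" "Re C = Re \<beta> + \<delta>" "Im C = Im \<beta> + \<delta>"
    by (simp_all add: A_def C_def)
  have AC: "Re A < Re C" "Im A < Im C" using le X(3) by (auto simp: A_def C_def)
  have seg1: "closed_segment A A2 = {z. Im z = Im A \<and> Re z \<in> {Re A..Re C}}"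
    and seg2: "closed_segment A2 C = {z. Re z = Re C \<and> Im z \<in> {Im A..Im C}}"
    and seg3: "closed_segment C A4 = {z. Im z = Im C \<and> Re z \<in> {Re A..Re C}}"
    and seg4: "closed_segment A4 A = {z. Re z = Re A \<and> Im z \<in> {Im A..Im C}}"
    using AC by (simp_all add: A2_def A4_def closed_segment_same_Im closed_segment_same_Re closed_segment_eq_real_ivl)
  have sub: "closed_segment A A2 \<subseteq> cbox A C" "closed_segment A2 C \<subseteq> cbox A C"
    "closed_segment C A4 \<subseteq> cbox A C" "closed_segment A4 A \<subseteq> cbox A C"
    using AC by (auto simp: seg1 seg2 seg3 seg4 in_cbox_complex_iff)
  define I where "I u v x = contour_integral (linepath u v) (\<lambda>\<zeta>. G (x(i := \<zeta>)) / (\<zeta> - x i)) / (2 * of_real pi * \<i>)" for u v x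
  define Y where "Y u v = X \<inter> (\<lambda>x. x i) -` (- closed_segment u v)" for u v
  have hI: "hol (I u v) (Y u v)" and oY: "open (Y u v)" if "closed_segment u v \<subseteq> cbox A C" for u v
  proof -
    have *: "\<And>x \<zeta>. x \<in> X \<Longrightarrow> \<zeta> \<in> closed_segment u v \<Longrightarrow> x(i := \<zeta>) \<in> U"
      using XU that unfolding A_def C_def by blast
    show "open (Y u v)" unfolding Y_def by (rule hol_segment_integral(2)[OF U(2) X(1) *])
    show "hol (I u v) (Y u v)" unfolding I_def Y_def
      by (rule hol_divide[OF hol_segment_integral(1)[OF U(2) X(1) *] hol_const]) auto
  qed
  note hI = hI[OF sub(1)] hI[OF sub(2)] hI[OF sub(3)] hI[OF sub(4)]
  note oY = oY[OF sub(1)] oY[OF sub(2)] oY[OF sub(3)] oY[OF sub(4)]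
  have cauchy: "G x = I A A2 x + I A2 C x + I C A4 x + I A4 A x"
    if x: "x \<in> X" "x i \<in> box A C" for x
  proof -
    have h: "(\<lambda>t. G (x(i := t))) holomorphic_on cbox A C"
      by (rule holomorphic_on_subset[OF hol_slice[OF U(2)]]) (use XU[folded A_def C_def] x in auto)
    have pi: "path_image (rectpath A C) \<subseteq> cbox A C - {x i}"
      using path_image_rectpath_cbox_minus_box[of A C] AC x by auto
    have w: "winding_number (rectpath A C) (x i) = 1"
      by (rule winding_number_rectpath[OF x(2)])
    have hc: "((\<lambda>\<zeta>. G (x(i := \<zeta>)) / (\<zeta> - x i)) has_contour_integral (2 * of_real pi * \<i> * G x)) (rectpath A C)"
      using Cauchy_integral_formula_convex_simple[OF convex_box(1) h _ valid_path_rectpath pi] x w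
      by (simp add: interior_cbox)
    have rp: "rectpath A C = linepath A A2 +++ linepath A2 C +++ linepath C A4 +++ linepath A4 A"
      by (simp add: rectpath_def Let_def A2_def A4_def)
    have "(\<lambda>\<zeta>. G (x(i := \<zeta>)) / (\<zeta> - x i)) contour_integrable_on rectpath A C"
      using hc contour_integrable_on_def by blast
    then have "contour_integral (rectpath A C) (\<lambda>\<zeta>. G (x(i := \<zeta>)) / (\<zeta> - x i)) =
      2 * of_real pi * \<i> * (I A A2 x + I A2 C x + I C A4 x + I A4 A x)"
      unfolding rp by (simp add: I_def distrib_left add.assoc)
    then show ?thesis using contour_integral_unique[OF hc] by simp
  qed
  define N where "N = X \<inter> (\<lambda>x. x i) -` box A C"
  have N: "open N" unfolding N_def
    by (intro open_Int X open_vimage open_box continuous_on_coordinate)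
  have "x i \<in> cbox \<alpha> \<beta>" if "x \<in> ?B" for x
    using that by (auto simp: Box_def split: if_splits dest: spec[of _ i])
  then have "x i \<in> box A C" if "x \<in> ?B" for x
    using that X(3) by (fastforce simp: in_box_complex_iff in_cbox_complex_iff A_def C_def)
  then have BN: "?B \<subseteq> N" using X(2) by (auto simp: N_def)
  \<comment> \<open>X ignores coordinate i, so it contains the two large boxes and not merely their
    common face.\<close>
  have inX: "x \<in> X" if "\<And>k. k \<noteq> i \<Longrightarrow> x k \<in> cbox (a k) (b k)" for x
  proof -
    have "x(i := \<alpha>) \<in> ?B"
      using that le by (auto simp: Box_def in_cbox_complex_iff)
    then have "x(i := \<alpha>, i := x i) \<in> X" using X by blast
    then show ?thesis by simp
  qed
  have B1X: "x \<in> X" "x i \<in> cbox (a i) \<beta>" if "x \<in> Box a (b(i := \<beta>))" for x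
    using that by (auto intro!: inX simp: Box_def split: if_splits dest: spec[of _ i])
  have B2X: "x \<in> X" "x i \<in> cbox \<alpha> (b i)" if "x \<in> Box (a(i := \<alpha>)) b" for x
    using that by (auto intro!: inX simp: Box_def split: if_splits dest: spec[of _ i])
  show ?thesis
  proof (cases s)
    case True
    then have s: "\<alpha> = Complex c (Im (a i))" "\<beta> = Complex c (Im (b i))" by (auto simp: ab set_part_def)
    \<comment> \<open>The left side has real part c - \<delta> and so misses the second box; the
      right side at c + \<delta>, and the bottom and top sides pushed out by \<delta>, miss the
      first.\<close>
    show ?thesis
    proof (rule that[of "Y A A2 \<inter> Y A2 C \<inter> Y C A4" "\<lambda>x. I A A2 x + I A2 C x + I C A4 x" "Y A4 A" "\<lambda>x. 0 - I A4 A x" N, folded ab])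
      show "hol (\<lambda>x. I A A2 x + I A2 C x + I C A4 x) (Y A A2 \<inter> Y A2 C \<inter> Y C A4)"
        by (intro hol_add hol_subset[OF hI(1)] hol_subset[OF hI(2)] hol_subset[OF hI(3)]) auto
      show "hol (\<lambda>x. 0 - I A4 A x) (Y A4 A)" by (intro hol_diff hol_const hI)
      show "Box a (b(i := \<beta>)) \<subseteq> Y A A2 \<inter> Y A2 C \<inter> Y C A4"
      proof
        fix x assume "x \<in> Box a (b(i := \<beta>))"
        from B1X[OF this] show "x \<in> Y A A2 \<inter> Y A2 C \<inter> Y C A4"
          using X(3) by (auto simp: Y_def seg1 seg2 seg3 in_cbox_complex_iff reim s)
      qed
      show "Box (a(i := \<alpha>)) b \<subseteq> Y A4 A"
      proof
        fix x assume "x \<in> Box (a(i := \<alpha>)) b"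
        from B2X[OF this] show "x \<in> Y A4 A"
          using X(3) by (auto simp: Y_def seg4 in_cbox_complex_iff reim s)
      qed
      show "G x = (I A A2 x + I A2 C x + I C A4 x) - (0 - I A4 A x)" if "x \<in> N" for x
        using cauchy[of x] that by (simp add: N_def)
    qed (use oY N BN in auto)
  next
    case False
    then have s: "\<alpha> = Complex (Re (a i)) c" "\<beta> = Complex (Re (b i)) c" by (auto simp: ab set_part_def)
    \<comment> \<open>With the cut in the imaginary direction, the bottom side at c - \<delta> takes
      the role of the left one.\<close>
    show ?thesis
    proof (rule that[of "Y A2 C \<inter> Y C A4 \<inter> Y A4 A" "\<lambda>x. I A2 C x + I C A4 x + I A4 A x" "Y A A2" "\<lambda>x. 0 - I A A2 x" N, folded ab])
      show "hol (\<lambda>x. I A2 C x + I C A4 x + I A4 A x) (Y A2 C \<inter> Y C A4 \<inter> Y A4 A)"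
        by (intro hol_add hol_subset[OF hI(2)] hol_subset[OF hI(3)] hol_subset[OF hI(4)]) auto
      show "hol (\<lambda>x. 0 - I A A2 x) (Y A A2)" by (intro hol_diff hol_const hI)
      show "Box a (b(i := \<beta>)) \<subseteq> Y A2 C \<inter> Y C A4 \<inter> Y A4 A"
      proof
        fix x assume "x \<in> Box a (b(i := \<beta>))"
        from B1X[OF this] show "x \<in> Y A2 C \<inter> Y C A4 \<inter> Y A4 A"
          using X(3) by (auto simp: Y_def seg2 seg3 seg4 in_cbox_complex_iff reim s)
      qed
      show "Box (a(i := \<alpha>)) b \<subseteq> Y A A2"
      proof
        fix x assume "x \<in> Box (a(i := \<alpha>)) b"
        from B2X[OF this] show "x \<in> Y A A2"
          using X(3) by (auto simp: Y_def seg1 in_cbox_complex_iff reim s)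
      qed
      show "G x = (I A2 C x + I C A4 x + I A4 A x) - (0 - I A A2 x)" if "x \<in> N" for x
        using cauchy[of x] that by (simp add: N_def)
    qed (use oY N BN in auto)
  qed
qed

section \<open>Extension from a graph to a box\<close>

text \<open>Boxes may be degenerate; finitely many non-degenerate sides make bisection terminate.\<close>

definition box_ok :: "(nat \<Rightarrow> complex) \<Rightarrow> (nat \<Rightarrow> complex) \<Rightarrow> bool" where
  "box_ok a b \<longleftrightarrow> (\<forall>k. cbox (a k) (b k) \<noteq> {}) \<and> finite {k. a k \<noteq> b k}"

lemma part_set_part [simp]: "part s (set_part s z u) = u"
  and set_part_part [simp]: "set_part s z (part s z) = z"
  and set_part_set_part [simp]: "set_part s (set_part s z u) v = set_part s z v"
  by (auto simp: part_def set_part_def)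

lemma box_ok_upd:
  assumes "box_ok a b" "part s (a i) \<le> u" "u \<le> v" "v \<le> part s (b i)"
  shows "box_ok (a(i := set_part s (a i) u)) (b(i := set_part s (b i) v))"
proof -
  have "finite {k. (a(i := set_part s (a i) u)) k \<noteq> (b(i := set_part s (b i) v)) k}"
    by (rule finite_subset[of _ "insert i {k. a k \<noteq> b k}"]) (use assms in \<open>auto simp: box_ok_def\<close>)
  then show ?thesis
    using assms by (auto simp: box_ok_def cbox_complex_ne_iff set_part_def part_def)
qed

text \<open>Deleting Q separates the two sets, and adding Q back to one neighbourhood confines the
  overlap to Q. In the merging step Q is the set where the data of the two solutions are
  compatible.\<close>

lemma separate_compact:
  fixes A B :: "'a::metric_space set"
  assumes "compact A" "compact B" "open Q" "A \<inter> B \<subseteq> Q"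
  obtains P R where "open P" "open R" "A \<subseteq> P" "B \<subseteq> R" "P \<inter> R \<subseteq> Q"
proof -
  have "compact (A - Q)" using assms by (simp add: compact_diff)
  moreover have "(A - Q) \<inter> B = {}" using assms by blast
  ultimately obtain P R where "open P" "open R" "A - Q \<subseteq> P" "B \<subseteq> R" "P \<inter> R = {}"
    using Hausdorff_space_compact_separation[of euclidean "A - Q" B] assms(2)
    by (auto simp: disjnt_def)
  then show ?thesis using that[of "P \<union> Q" R] assms(3) by blast
qed

lemma Box_upd_iff:
  "x \<in> Box (a(i := \<alpha>)) (b(i := \<beta>)) \<longleftrightarrow>
    x i \<in> cbox \<alpha> \<beta> \<and> (\<forall>k. k \<noteq> i \<longrightarrow> x k \<in> cbox (a k) (b k))"
  unfolding Box_def mem_Collect_eq by (metis fun_upd_other fun_upd_same)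

text \<open>By \<open>p_upd\<close> no \<open>p j\<close> with j in J depends on the coordinates in
  J. The solution set is then a graph over the remaining coordinates, and the equations may be
  solved in any order.\<close>

locale graph_equations =
  fixes p :: "nat \<Rightarrow> (nat \<Rightarrow> complex) \<Rightarrow> complex" and J :: "nat set"
  assumes finite_J: "finite J"
    and hol_p: "\<And>j. j \<in> J \<Longrightarrow> hol (p j) UNIV"
    and p_upd: "\<And>i j x t. i \<in> J \<Longrightarrow> j \<in> J \<Longrightarrow> p j (x(i := t)) = p j x"
begin

definition gr :: "nat set \<Rightarrow> (nat \<Rightarrow> complex) set" where
  "gr K = {x. \<forall>j\<in>K. x j = p j x}"

text \<open>For K inside J this is a retraction onto \<open>gr K\<close>. It pulls functions near
  \<open>gr K\<close> back to functions that do not depend on the coordinates in K.\<close>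

definition proj :: "nat set \<Rightarrow> (nat \<Rightarrow> complex) \<Rightarrow> nat \<Rightarrow> complex" where
  "proj K x = (\<lambda>i. if i \<in> K then p i x else x i)"

lemma continuous_p: "j \<in> J \<Longrightarrow> continuous_on S (p j)"
  using hol_p[of j] by (auto simp: hol_def intro: continuous_on_subset)

lemma closed_gr: assumes "K \<subseteq> J" shows "closed (gr K)"
proof -
  have "gr K = (\<Inter>j\<in>K. {x. x j = p j x})" by (auto simp: gr_def)
  also have "closed \<dots>"
    using assms by (intro closed_INT ballI closed_Collect_eq continuous_on_coordinate continuous_p) auto
  finally show ?thesis .
qed

lemma proj_insert: "proj (insert k K) x = (proj K x)(k := p k x)"
  by (auto simp: proj_def)

lemma p_proj: assumes "K \<subseteq> J" "j \<in> J" shows "p j (proj K x) = p j x"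
proof -
  have "finite K" using assms(1) finite_J finite_subset by blast
  then show ?thesis using assms(1)
  proof (induction K)
    case empty
    have "proj {} x = x" by (simp add: proj_def)
    then show ?case by simp
  next
    case (insert k K)
    then show ?case unfolding proj_insert using p_upd[of k j "proj K x" "p k x"] assms(2) by (metis insert_subset)
  qed
qed

lemma proj_gr: "x \<in> gr K \<Longrightarrow> proj K x = x"
  by (auto simp: gr_def proj_def)

lemma proj_in_gr: assumes "K \<subseteq> J" shows "proj K x \<in> gr K"
  unfolding gr_def
proof (intro CollectI ballI)
  fix j assume "j \<in> K"
  moreover from this have "p j (proj K x) = p j x" using assms by (intro p_proj) auto
  ultimately show "proj K x j = p j (proj K x)" by (simp only: proj_def if_True)
qed

text \<open>The equations are substituted one at a time by \<open>hol_substitute\<close>; by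
  \<open>p_proj\<close> the substitutions do not disturb one another.\<close>

lemma
  assumes "K \<subseteq> J"
  shows hol_proj: "open U \<Longrightarrow> hol F U \<Longrightarrow> hol (\<lambda>x. F (proj K x)) {x. proj K x \<in> U}"
    and open_proj: "open U \<Longrightarrow> open {x. proj K x \<in> U}"
proof -
  have "finite K" using assms(1) finite_J finite_subset by blast
  then have "(open U \<longrightarrow> open {x. proj K x \<in> U}) \<and>
    (open U \<longrightarrow> hol F U \<longrightarrow> hol (\<lambda>x. F (proj K x)) {x. proj K x \<in> U})" using assms
  proof (induction K arbitrary: U F)
    case empty
    have "proj {} x = x" for x by (simp add: proj_def)
    then show ?case by simp
  next
    case (insert k K)
    then have k: "k \<in> J" "K \<subseteq> J" by auto
    let ?U = "{y. y(k := p k y) \<in> U}" and ?F = "\<lambda>y. F (y(k := p k y))"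
    have eq: "proj (insert k K) x = (proj K x)(k := p k (proj K x))" for x
      using p_proj[OF k(2,1)] by (simp add: proj_insert)
    have "open ?U" if "open U" by (rule open_upd[OF that continuous_p[OF k(1)]])
    moreover have "hol ?F ?U" if "open U" "hol F U" by (rule hol_substitute[OF that hol_p[OF k(1)]])
    ultimately show ?case using insert.IH[OF k(2), of ?U ?F] unfolding eq mem_Collect_eq by blast
  qed
  then show "open U \<Longrightarrow> open {x. proj K x \<in> U}"
    "open U \<Longrightarrow> hol F U \<Longrightarrow> hol (\<lambda>x. F (proj K x)) {x. proj K x \<in> U}" by blast+
qed

text \<open>\<open>L\<close> contains the equations of the submanifold carrying \<open>f\<close>, and \<open>K\<close> those of the submanifold
  near which the extension is required; \<open>K = {}\<close> is extension to the whole box.\<close>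

definition extendable :: "nat set \<Rightarrow> nat set \<Rightarrow> ((nat \<Rightarrow> complex) \<Rightarrow> complex) \<Rightarrow>
    (nat \<Rightarrow> complex) \<Rightarrow> (nat \<Rightarrow> complex) \<Rightarrow> bool" where
  "extendable L K f a b \<longleftrightarrow> (\<exists>W F V. open W \<and> hol F W \<and> Box a b \<inter> gr K \<subseteq> W \<and>
     open V \<and> Box a b \<inter> gr L \<subseteq> V \<and> (\<forall>x\<in>V \<inter> gr L. F x = f x))"

text \<open>The two solutions differ, after projection, by a multiple \<open>(x k - p k x) * h x\<close>. By
  \<open>ext\<close>, \<open>h\<close> extends to the common face, splits there as \<open>G1 - G2\<close>, and
  subtracting \<open>(x k - p k x) * Gi x\<close> makes the two solutions agree.\<close>

lemma extendable_merge:
  assumes K: "insert k K \<subseteq> J" "k \<notin> K"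
    and ext: "\<And>f a b U. box_ok a b \<Longrightarrow> open U \<Longrightarrow> hol f U \<Longrightarrow> Box a b \<inter> gr K \<subseteq> U \<Longrightarrow> extendable K {} f a b"
    and ab: "box_ok a b" and c: "part s (a i) \<le> c" "c \<le> part s (b i)"
    and sol1: "extendable (insert k K) K f a (b(i := set_part s (b i) c))"
    and sol2: "extendable (insert k K) K f (a(i := set_part s (a i) c)) b"
  shows "extendable (insert k K) K f a b"
proof -
  define B1 B2 B12 where "B1 = Box a (b(i := set_part s (b i) c))"
    and "B2 = Box (a(i := set_part s (a i) c)) b"
    and "B12 = Box (a(i := set_part s (a i) c)) (b(i := set_part s (b i) c))"
  have KJ: "K \<subseteq> J" "k \<in> J" using K by auto
  have ne: "cbox (a j) (b j) \<noteq> {}" for j using ab by (auto simp: box_ok_def)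
  have neR: "Re (a i) \<le> Re (b i)" "Im (a i) \<le> Im (b i)"
    using ne[of i] by (auto simp: cbox_complex_ne_iff)
  have i1: "cbox (a i) (set_part s (b i) c) \<inter> cbox (set_part s (a i) c) (b i) =
      cbox (set_part s (a i) c) (set_part s (b i) c)"
    and i2: "cbox (a i) (set_part s (b i) c) \<union> cbox (set_part s (a i) c) (b i) = cbox (a i) (b i)"
    using neR c by (auto simp: in_cbox_complex_iff set_part_def part_def)
  have B_Int: "B1 \<inter> B2 = B12"
  proof -
    have "(x \<in> B1 \<and> x \<in> B2) = (x \<in> B12)" for x
      unfolding B1_def B2_def B12_def Box_def mem_Collect_eq using i1 by (auto split: if_splits)
    then show ?thesis by blast
  qed
  have B_Un: "Box a b \<subseteq> B1 \<union> B2"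
  proof
    fix x assume x: "x \<in> Box a b"
    then have "x i \<in> cbox (a i) (set_part s (b i) c) \<or> x i \<in> cbox (set_part s (a i) c) (b i)"
      using i2 by (auto simp: Box_def)
    then show "x \<in> B1 \<union> B2" using x by (auto simp: B1_def B2_def Box_def)
  qed
  obtain W1 F1 V1 where W1: "open W1" "hol F1 W1" "B1 \<inter> gr K \<subseteq> W1" "open V1"
    "B1 \<inter> gr (insert k K) \<subseteq> V1" "\<And>x. x \<in> V1 \<inter> gr (insert k K) \<Longrightarrow> F1 x = f x"
    using sol1 unfolding extendable_def B1_def by blast
  obtain W2 F2 V2 where W2: "open W2" "hol F2 W2" "B2 \<inter> gr K \<subseteq> W2" "open V2"
    "B2 \<inter> gr (insert k K) \<subseteq> V2" "\<And>x. x \<in> V2 \<inter> gr (insert k K) \<Longrightarrow> F2 x = f x"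
    using sol2 unfolding extendable_def B2_def by blast
  let ?r = "proj K"
  have rk: "?r x k = x k" for x using K(2) by (simp add: proj_def)
  have pk: "p k (?r x) = p k x" for x by (rule p_proj[OF KJ])
  have r_gr: "?r x \<in> gr K" for x by (rule proj_in_gr[OF KJ(1)])
  have r_gr': "?r x \<in> gr (insert k K) \<longleftrightarrow> x k = p k x" for x
    using r_gr[of x] by (simp add: gr_def rk pk)
  have hol_d: "hol (\<lambda>x. x k - p k x) U" for U
    by (intro hol_diff hol_coord hol_subset[OF hol_p[OF KJ(2)]]) simp
  \<comment> \<open>F1 and F2 are only known to agree on parts of \<open>gr (insert k K)\<close>,
    but after composition with \<open>?r\<close> their difference vanishes at every point of W with
    \<open>x k = p k x\<close>, so one equation can be divided out. The second factor discards
    points of that hypersurface whose projection leaves \<open>V1\<close> or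
    \<open>V2\<close>.\<close>
  define W where "W = {x. ?r x \<in> W1 \<inter> W2} \<inter> ({x. ?r x \<in> V1 \<inter> V2} \<union> {x. x k \<noteq> p k x})"
  have oW: "open W" unfolding W_def
    by (intro open_Int open_Un open_proj[OF KJ(1)] W1 W2 open_Collect_neq continuous_on_coordinate continuous_p KJ)
  have hr1: "hol (\<lambda>x. F1 (?r x)) {x. ?r x \<in> W1}" and hr2: "hol (\<lambda>x. F2 (?r x)) {x. ?r x \<in> W2}"
    by (rule hol_proj[OF KJ(1)]; fact)+
  have hH: "hol (\<lambda>x. F1 (?r x) - F2 (?r x)) W"
    by (intro hol_diff hol_subset[OF hr1] hol_subset[OF hr2]) (auto simp: W_def)
  obtain h where h: "hol h W" "\<And>x. x \<in> W \<Longrightarrow> F1 (?r x) - F2 (?r x) = (x k - p k x) * h x"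
  proof (rule hol_divide_graph[OF oW hH hol_p[OF KJ(2)]])
    show "p k (x(k := t)) = p k x" for x t by (rule p_upd[OF KJ(2) KJ(2)])
    show "F1 (?r x) - F2 (?r x) = 0" if "x \<in> W" "x k = p k x" for x
      using that r_gr' W1(6) W2(6) by (auto simp: W_def)
  qed (rule that)
  have BW: "B12 \<inter> gr K \<subseteq> W"
  proof
    fix x assume x: "x \<in> B12 \<inter> gr K"
    then have rx: "?r x = x" and x12: "x \<in> B1" "x \<in> B2" using proj_gr B_Int by auto
    show "x \<in> W"
      using x12 x W1(3,5) W2(3,5) r_gr'[of x] unfolding W_def rx by (auto simp: rx)
  qed
  have ok12: "box_ok (a(i := set_part s (a i) c)) (b(i := set_part s (b i) c))"
    using box_ok_upd[OF ab c(1) order_refl c(2)] .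
  obtain Wg G Vg where G: "open Wg" "hol G Wg" "B12 \<subseteq> Wg" "open Vg" "B12 \<inter> gr K \<subseteq> Vg"
    "\<And>x. x \<in> Vg \<inter> gr K \<Longrightarrow> G x = h x"
    using ext[OF ok12 oW h(1) BW[unfolded B12_def]] unfolding extendable_def B12_def by (auto simp: gr_def)
  obtain G1 N1 G2 N2 N where N: "open N1" "hol G1 N1" "B1 \<subseteq> N1" "open N2" "hol G2 N2" "B2 \<subseteq> N2"
    "open N" "B12 \<subseteq> N" "\<And>x. x \<in> N \<Longrightarrow> G x = G1 x - G2 x"
    using cousin_split[OF G(1,2) ne c G(3)[unfolded B12_def]] unfolding B1_def B2_def B12_def by metis
  have cpt: "compact (B1 \<inter> gr K)" "compact (B2 \<inter> gr K)"
    unfolding B1_def B2_def using compact_Box closed_gr[OF KJ(1)] by (simp_all add: compact_Int_closed)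
  \<comment> \<open>The overlap of the two domains is to be confined to the set on which the
    extension of h, the splitting of G and the division all hold.\<close>
  have "(B1 \<inter> gr K) \<inter> (B2 \<inter> gr K) \<subseteq> Vg \<inter> N \<inter> W" using B_Int G(5) N(8) BW by blast
  then obtain P1 P2 where P: "open P1" "open P2" "B1 \<inter> gr K \<subseteq> P1" "B2 \<inter> gr K \<subseteq> P2" "P1 \<inter> P2 \<subseteq> Vg \<inter> N \<inter> W"
    using separate_compact[OF cpt] oW G(4) N(7) by (metis open_Int)
  define O1 O2 where "O1 = {x. ?r x \<in> P1 \<inter> W1 \<inter> N1}" and "O2 = {x. ?r x \<in> P2 \<inter> W2 \<inter> N2}"
  have oO: "open O1" "open O2"
    unfolding O1_def O2_def by (intro open_proj[OF KJ(1)] open_Int P W1 W2 N)+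
  \<comment> \<open>The corrections carry the factor \<open>x k - p k x\<close>, so the prescribed
    values on \<open>gr (insert k K)\<close> survive.\<close>
  let ?F1 = "\<lambda>x. F1 (?r x) - (x k - p k x) * G1 (?r x)"
  let ?F2 = "\<lambda>x. F2 (?r x) - (x k - p k x) * G2 (?r x)"
  have agree: "?F1 x = ?F2 x" if "x \<in> O1" "x \<in> O2" for x
  proof -
    have q: "?r x \<in> Vg" "?r x \<in> N" "?r x \<in> W" using that P(5) by (auto simp: O1_def O2_def)
    have "?r (?r x) = ?r x" using r_gr proj_gr by blast
    then have "F1 (?r x) - F2 (?r x) = (x k - p k x) * h (?r x)"
      using h(2)[OF q(3)] by (simp add: rk pk)
    also have "h (?r x) = G1 (?r x) - G2 (?r x)" using G(6)[of "?r x"] N(9)[OF q(2)] q(1) r_gr by auto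
    finally show ?thesis by (simp add: algebra_simps)
  qed
  define F where "F x = (if x \<in> O1 then ?F1 x else ?F2 x)" for x
  have F2: "F x = ?F2 x" if "x \<in> O2" for x using agree that by (auto simp: F_def)
  have hg1: "hol (\<lambda>x. G1 (?r x)) {x. ?r x \<in> N1}" and hg2: "hol (\<lambda>x. G2 (?r x)) {x. ?r x \<in> N2}"
    by (rule hol_proj[OF KJ(1)]; fact)+
  have hO1: "hol ?F1 O1"
    by (intro hol_diff hol_mult hol_d hol_subset[OF hr1] hol_subset[OF hg1]) (auto simp: O1_def)
  have hO2: "hol ?F2 O2"
    by (intro hol_diff hol_mult hol_d hol_subset[OF hr2] hol_subset[OF hg2]) (auto simp: O2_def)
  have "hol F (O1 \<union> O2)"
    by (intro hol_union oO hol_cong[OF oO(1) hO1] hol_cong[OF oO(2) hO2]) (auto simp: F_def agree)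
  moreover have "Box a b \<inter> gr K \<subseteq> O1 \<union> O2"
  proof
    fix x assume x: "x \<in> Box a b \<inter> gr K"
    then have rx: "?r x = x" using proj_gr by auto
    show "x \<in> O1 \<union> O2" using x B_Un W1(3) W2(3) P(3,4) N(3,6) by (auto simp: O1_def O2_def rx)
  qed
  moreover have "open (O1 \<inter> V1 \<union> O2 \<inter> V2)" using oO W1 W2 by auto
  moreover have "Box a b \<inter> gr (insert k K) \<subseteq> O1 \<inter> V1 \<union> O2 \<inter> V2"
  proof
    fix x assume x: "x \<in> Box a b \<inter> gr (insert k K)"
    then have g: "x \<in> gr K" by (auto simp: gr_def)
    then have rx: "?r x = x" using proj_gr by auto
    show "x \<in> O1 \<inter> V1 \<union> O2 \<inter> V2"
      using x g B_Un W1(3,5) W2(3,5) P(3,4) N(3,6) by (auto simp: O1_def O2_def rx)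
  qed
  moreover have "F x = f x" if x: "x \<in> (O1 \<inter> V1 \<union> O2 \<inter> V2) \<inter> gr (insert k K)" for x
  proof -
    have rx: "?r x = x" and d: "x k = p k x" using x proj_gr by (auto simp: gr_def)
    show ?thesis using x W1(6)[of x] W2(6)[of x] F2[of x] by (auto simp: F_def rx d)
  qed
  ultimately show ?thesis unfolding extendable_def using oO by blast
qed

text \<open>Where subdivision ends: over a single point f is its own extension, and a point off
  \<open>gr L\<close> prescribes nothing.\<close>

lemma extendable_point:
  assumes "open U" "hol f U" "Box a a \<inter> gr L \<subseteq> U"
  shows "extendable L K f a a"
proof -
  have B: "Box a a = {a}" by (auto simp: Box_def)
  show ?thesis
  proof (cases "a \<in> gr L")
    case True
    then have "a \<in> U" using assms(3) B by auto
    then show ?thesis unfolding extendable_def B using assms(1,2) by blast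
  next
    case False
    then show ?thesis unfolding extendable_def B
      by (intro exI[of _ UNIV] exI[of _ "\<lambda>x. 0"] exI[of _ "{}"]) auto
  qed
qed

text \<open>Extendability is an open condition, being stated with open neighbourhoods of compact
  sets, so a flat slice may be thickened a little.\<close>

lemma extendable_nearby:
  assumes K: "K \<subseteq> J" and L: "L \<subseteq> J"
    and ab: "box_ok a b"
    and ext: "extendable L K f (a(i := set_part s (a i) t)) (b(i := set_part s (b i) t))"
  obtains d where "d > 0"
    "\<And>u v. u \<le> t \<Longrightarrow> t \<le> v \<Longrightarrow> v - u < d \<Longrightarrow>
      extendable L K f (a(i := set_part s (a i) u)) (b(i := set_part s (b i) v))"
proof -
  define \<alpha> \<beta> where "\<alpha> = set_part s (a i) t" and "\<beta> = set_part s (b i) t"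
  have neR: "Re (a i) \<le> Re (b i)" "Im (a i) \<le> Im (b i)"
    using ab by (auto simp: box_ok_def cbox_complex_ne_iff)
  obtain W F V where W: "open W" "hol F W" "Box (a(i := \<alpha>)) (b(i := \<beta>)) \<inter> gr K \<subseteq> W" "open V"
    "Box (a(i := \<alpha>)) (b(i := \<beta>)) \<inter> gr L \<subseteq> V" "\<And>x. x \<in> V \<inter> gr L \<Longrightarrow> F x = f x"
    using ext unfolding extendable_def \<alpha>_def \<beta>_def by blast
  \<comment> \<open>Adding the complements of the closed sets \<open>gr K\<close> and
    \<open>gr L\<close> turns conditions on two parts of the box into one open set around the whole
    box, as \<open>Box_tube\<close> requires.\<close>
  let ?U = "(W \<union> - gr K) \<inter> (V \<union> - gr L)"
  have U: "open ?U" using W closed_gr[OF K] closed_gr[OF L] by auto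
  have BU: "Box (a(i := \<alpha>)) (b(i := \<beta>)) \<subseteq> ?U" using W by blast
  have ne: "cbox ((a(i := \<alpha>)) i) ((b(i := \<beta>)) i) \<noteq> {}"
    using neR by (auto simp: \<alpha>_def \<beta>_def set_part_def cbox_complex_ne_iff)
  obtain X \<delta> where X: "open X" "Box (a(i := \<alpha>)) (b(i := \<beta>)) \<subseteq> X" "0 < \<delta>"
    "\<And>x t. x \<in> X \<Longrightarrow> x(i := t) \<in> X"
    and XU: "\<And>x \<zeta>. x \<in> X \<Longrightarrow> \<zeta> \<in> cbox ((a(i := \<alpha>)) i - Complex \<delta> \<delta>) ((b(i := \<beta>)) i + Complex \<delta> \<delta>) \<Longrightarrow> x(i := \<zeta>) \<in> ?U"
    by (rule Box_tube[OF U BU ne]) (rule that)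
  have "extendable L K f (a(i := set_part s (a i) u)) (b(i := set_part s (b i) v))"
    if uv: "u \<le> t" "t \<le> v" "v - u < \<delta>" for u v
  proof -
    have "Box (a(i := set_part s (a i) u)) (b(i := set_part s (b i) v)) \<subseteq> ?U"
    proof
      fix x assume x: "x \<in> Box (a(i := set_part s (a i) u)) (b(i := set_part s (b i) v))"
      have "x(i := \<alpha>) \<in> Box (a(i := \<alpha>)) (b(i := \<beta>))"
        using x ne by (auto simp: Box_upd_iff in_cbox_complex_iff cbox_complex_ne_iff)
      then have "x(i := \<alpha>, i := x i) \<in> X" using X by blast
      then have "x \<in> X" by simp
      moreover have "x i \<in> cbox (set_part s (a i) u) (set_part s (b i) v)"
        using x by (simp add: Box_upd_iff)
      then have "x i \<in> cbox ((a(i := \<alpha>)) i - Complex \<delta> \<delta>) ((b(i := \<beta>)) i + Complex \<delta> \<delta>)"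
        using uv X(3) by (auto simp: in_cbox_complex_iff \<alpha>_def \<beta>_def set_part_def split: if_splits)
      ultimately have "x(i := x i) \<in> ?U" by (rule XU)
      then show "x \<in> ?U" by simp
    qed
    then have "Box (a(i := set_part s (a i) u)) (b(i := set_part s (b i) v)) \<inter> gr K \<subseteq> W"
      "Box (a(i := set_part s (a i) u)) (b(i := set_part s (b i) v)) \<inter> gr L \<subseteq> V" by blast+
    then show ?thesis
      unfolding extendable_def
      by (intro exI[of _ W] exI[of _ F] exI[of _ V]) (use W in auto)
  qed
  then show ?thesis using that X(3) by blast
qed

text \<open>D contains the real directions in which the box may have positive length. A slice across
  one of them has fewer such directions, so it is extendable by induction and stays so when
  thickened; Bolzano's bisection principle then glues the slabs by
  \<open>extendable_merge\<close>.\<close>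

lemma extendable_induct_parts:
  assumes K: "insert k K \<subseteq> J" "k \<notin> K"
    and ext: "\<And>f a b U. box_ok a b \<Longrightarrow> open U \<Longrightarrow> hol f U \<Longrightarrow> Box a b \<inter> gr K \<subseteq> U \<Longrightarrow> extendable K {} f a b"
    and U: "open U" "hol f U"
    and D: "finite D"
    and ab: "box_ok a b" "\<And>i s. (i, s) \<notin> D \<Longrightarrow> part s (a i) = part s (b i)"
    and BU: "Box a b \<inter> gr (insert k K) \<subseteq> U"
  shows "extendable (insert k K) K f a b"
  using D ab BU
proof (induction D arbitrary: a b)
  case empty
  have "a i = b i" for i
    using empty(2)[of i True] empty(2)[of i False] by (simp add: part_def complex_eq_iff)
  then have "a = b" by blast
  then show ?case using extendable_point[OF U] empty by blast
next
  case (insert d D)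
  obtain i s where d: "d = (i, s)" by (cases d)
  have neR: "Re (a i) \<le> Re (b i)" "Im (a i) \<le> Im (b i)"
    using insert.prems(1) by (auto simp: box_ok_def cbox_complex_ne_iff)
  let ?E = "\<lambda>u v. extendable (insert k K) K f (a(i := set_part s (a i) u)) (b(i := set_part s (b i) v))"
  let ?P = "\<lambda>u v. part s (a i) \<le> u \<longrightarrow> u \<le> v \<longrightarrow> v \<le> part s (b i) \<longrightarrow> ?E u v"
  have "part s (a i) \<le> part s (b i)" using neR by (simp add: part_def)
  then have "?P (part s (a i)) (part s (b i))"
  proof (induction rule: Bolzano[where P = ?P])
    case (trans u v w)
    show ?case
    proof (intro impI)
      assume *: "part s (a i) \<le> u" "u \<le> w" "w \<le> part s (b i)"
      let ?a = "a(i := set_part s (a i) u)" and ?b = "b(i := set_part s (b i) w)"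
      show "?E u w"
      proof (rule extendable_merge[OF K ext, where c = v and s = s and i = i])
        show "box_ok ?a ?b" by (rule box_ok_upd[OF insert.prems(1) *])
        have le: "v \<le> part s (b i)" "part s (a i) \<le> v" using trans(3,4) * by linarith+
        have "?E u v" "?E v w"
          using trans(1)[rule_format, OF *(1) trans(3) le(1)] trans(2)[rule_format, OF le(2) trans(4) *(3)] .
        then show "extendable (insert k K) K f ?a (?b(i := set_part s (?b i) v))"
          "extendable (insert k K) K f (?a(i := set_part s (?a i) v)) ?b"
          by (simp_all only: fun_upd_same fun_upd_upd set_part_set_part)
      qed (use trans(3,4) in simp_all)
    qed
  next
    case (local t)
    have "?E t t"
    proof (rule insert.IH)
      show "box_ok (a(i := set_part s (a i) t)) (b(i := set_part s (b i) t))"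
        using box_ok_upd[OF insert.prems(1) local(1) order_refl local(2)] .
      show "part s' ((a(i := set_part s (a i) t)) i') = part s' ((b(i := set_part s (b i) t)) i')"
        if "(i', s') \<notin> D" for i' s'
      proof (cases "(i', s') = d")
        case True then show ?thesis using d by simp
      next
        case False
        then have "part s' (a i') = part s' (b i')" using insert.prems(2) that by blast
        then show ?thesis using False d by (auto simp: part_def set_part_def)
      qed
      have "Box (a(i := set_part s (a i) t)) (b(i := set_part s (b i) t)) \<subseteq> Box a b"
      proof
        fix x assume x: "x \<in> Box (a(i := set_part s (a i) t)) (b(i := set_part s (b i) t))"
        have "x j \<in> cbox (a j) (b j)" for j
          using x local by (cases "j = i")
            (auto simp: Box_upd_iff in_cbox_complex_iff set_part_def part_def split: if_splits)
        then show "x \<in> Box a b" by (simp add: Box_def)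
      qed
      then show "Box (a(i := set_part s (a i) t)) (b(i := set_part s (b i) t)) \<inter> gr (insert k K) \<subseteq> U"
        using insert.prems(3) by blast
    qed
    then obtain d where "d > 0"
      "\<And>u v. u \<le> t \<Longrightarrow> t \<le> v \<Longrightarrow> v - u < d \<Longrightarrow> ?E u v"
      using extendable_nearby[OF _ K(1) insert.prems(1)] K(1) by blast
    then show ?case by blast
  qed
  then show ?case using \<open>part s (a i) \<le> part s (b i)\<close> by simp
qed

text \<open>Dropping one equation leads from \<open>gr (insert k K)\<close> to a neighbourhood of
  \<open>gr K\<close>, and the hypothesis for K leads from there to the box.\<close>

theorem graph_extension:
  assumes "K \<subseteq> J" "box_ok a b" "open U" "hol f U" "Box a b \<inter> gr K \<subseteq> U"
  shows "extendable K {} f a b"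
proof -
  have "finite K" using assms(1) finite_J finite_subset by blast
  then show ?thesis using assms
  proof (induction K arbitrary: a b f U)
    case empty
    then show ?case unfolding extendable_def by blast
  next
    case (insert k K)
    have ext: "extendable K {} f a b" if "box_ok a b" "open U" "hol f U" "Box a b \<inter> gr K \<subseteq> U" for f a b U
      using insert.IH[OF _ that] insert.prems(1) by blast
    have "finite ({i. a i \<noteq> b i} \<times> (UNIV :: bool set))"
      using insert.prems(2) by (simp add: box_ok_def)
    from extendable_induct_parts[OF insert.prems(1) insert.hyps(2) ext insert.prems(3,4) this insert.prems(2) _ insert.prems(5)]
    have "extendable (insert k K) K f a b" by auto
    then obtain W F V where W: "open W" "hol F W" "Box a b \<inter> gr K \<subseteq> W" "open V"
      "Box a b \<inter> gr (insert k K) \<subseteq> V" "\<And>x. x \<in> V \<inter> gr (insert k K) \<Longrightarrow> F x = f x"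
      unfolding extendable_def by blast
    obtain W' F' V' where W': "open W'" "hol F' W'" "Box a b \<inter> gr {} \<subseteq> W'" "open V'"
      "Box a b \<inter> gr K \<subseteq> V'" "\<And>x. x \<in> V' \<inter> gr K \<Longrightarrow> F' x = F x"
      using ext[OF insert.prems(2) W(1-3)] unfolding extendable_def by blast
    have sub: "gr (insert k K) \<subseteq> gr K" by (auto simp: gr_def)
    have "open (V \<inter> V')" "Box a b \<inter> gr (insert k K) \<subseteq> V \<inter> V'"
      "\<forall>x\<in>V \<inter> V' \<inter> gr (insert k K). F' x = f x"
      using W W' sub by (auto 4 3)
    then show ?case unfolding extendable_def using W' by blast
  qed
qed

end

section \<open>Polynomial approximation on polydiscs\<close>

text \<open>Generation by closure rules makes the substitution of polynomials for coordinates, as in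
  \<open>complex_polynomial_pol\<close>, a rule induction.\<close>

inductive_set pol :: "((nat \<Rightarrow> complex) \<Rightarrow> complex) set" where
  pol_const: "(\<lambda>x. c) \<in> pol"
| pol_coord: "(\<lambda>x. x i) \<in> pol"
| pol_add: "P \<in> pol \<Longrightarrow> Q \<in> pol \<Longrightarrow> (\<lambda>x. P x + Q x) \<in> pol"
| pol_mult: "P \<in> pol \<Longrightarrow> Q \<in> pol \<Longrightarrow> (\<lambda>x. P x * Q x) \<in> pol"

lemma pol_sum: "(\<And>i. i \<in> I \<Longrightarrow> P i \<in> pol) \<Longrightarrow> (\<lambda>x. \<Sum>i\<in>I. P i x) \<in> pol"
  by (induction I rule: infinite_finite_induct) (simp_all add: pol_const pol_add)

lemma pol_power: "P \<in> pol \<Longrightarrow> (\<lambda>x. P x ^ n) \<in> pol"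
  by (induction n) (simp_all add: pol_const pol_mult)

lemma pol_upd_const: "P \<in> pol \<Longrightarrow> (\<lambda>x. P (x(j := c))) \<in> pol"
proof (induction rule: pol.induct)
  case (pol_coord i)
  then show ?case by (cases "i = j") (auto intro: pol.intros)
qed (auto intro: pol.intros)

definition polydisc :: "(nat \<Rightarrow> real) \<Rightarrow> (nat \<Rightarrow> complex) set" where
  "polydisc \<rho> = {x. \<forall>i. cmod (x i) \<le> \<rho> i}"

lemma compact_polydisc: "compact (polydisc \<rho>)"
proof -
  have "polydisc \<rho> = PiE UNIV (\<lambda>i. cball 0 (\<rho> i))"
    by (auto simp: polydisc_def PiE_def)
  then have "compactin (product_topology (\<lambda>i. euclidean) UNIV) (polydisc \<rho>)"
    by (simp add: compactin_PiE)
  then show ?thesis by (simp add: euclidean_product_topology)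
qed

lemma open_upd_compact:
  assumes "open U" "compact S"
  shows "open {x::nat \<Rightarrow> complex. \<forall>\<zeta>\<in>S. x(j := \<zeta>) \<in> U}"
  unfolding open_subopen[of "{x. \<forall>\<zeta>\<in>S. x(j := \<zeta>) \<in> U}"]
proof (intro ballI)
  let ?W = "(\<lambda>p. (fst p)(j := snd p)) -` U"
  fix x assume "x \<in> {x. \<forall>\<zeta>\<in>S. x(j := \<zeta>) \<in> U}"
  then have "{x} \<times> S \<subseteq> ?W" by auto
  moreover have "open ?W" by (intro open_vimage assms continuous_on_upd_fst_snd)
  ultimately obtain X Y where XY: "open X" "open Y" "{x} \<subseteq> X" "S \<subseteq> Y" "X \<times> Y \<subseteq> ?W"
    using Wallace_theorem_prod_topology[of euclidean "{x}" euclidean S ?W] assms(2) by auto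
  then have "X \<subseteq> {x. \<forall>\<zeta>\<in>S. x(j := \<zeta>) \<in> U}" by fastforce
  then show "\<exists>T. open T \<and> x \<in> T \<and> T \<subseteq> {x. \<forall>\<zeta>\<in>S. x(j := \<zeta>) \<in> U}" using XY by blast
qed

text \<open>A finite geometric sum with its exact remainder, which makes the error after M Taylor
  terms explicit.\<close>

lemma geometric_kernel:
  fixes w \<zeta> :: "'a::field"
  assumes "\<zeta> \<noteq> 0" "\<zeta> \<noteq> w"
  shows "1 / (\<zeta> - w) - (\<Sum>m<M. w ^ m / \<zeta> ^ Suc m) = (w / \<zeta>) ^ M / (\<zeta> - w)"
proof (induction M)
  case (Suc M)
  have "1 / (\<zeta> - w) - (\<Sum>m<Suc M. w ^ m / \<zeta> ^ Suc m) = (w / \<zeta>) ^ M / (\<zeta> - w) - w ^ M / \<zeta> ^ Suc M"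
    using Suc by (simp add: algebra_simps)
  also have "\<dots> = (w / \<zeta>) ^ M * (1 / (\<zeta> - w) - 1 / \<zeta>)"
    by (simp add: power_divide right_diff_distrib)
  also have "1 / (\<zeta> - w) - 1 / \<zeta> = (w / \<zeta>) / (\<zeta> - w)"
    using assms by (simp add: diff_frac_eq)
  finally show ?case by (simp add: ac_simps)
qed simp

text \<open>Cauchy's integral for the m-th Taylor coefficient in coordinate j about 0, kept as a
  function of the other coordinates so that the approximation can recurse.\<close>

definition taylor_coeff :: "((nat \<Rightarrow> complex) \<Rightarrow> complex) \<Rightarrow> nat \<Rightarrow> real \<Rightarrow> nat \<Rightarrow> (nat \<Rightarrow> complex) \<Rightarrow> complex" where
  "taylor_coeff F j R m x =
     contour_integral (circlepath 0 R) (\<lambda>\<zeta>. F (x(j := \<zeta>)) / \<zeta> ^ Suc m) / (2 * of_real pi * \<i>)"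

lemma taylor_coeff_upd [simp]: "taylor_coeff F j R m (x(j := t)) = taylor_coeff F j R m x"
  by (simp add: taylor_coeff_def)

lemma hol_taylor_coeff:
  assumes U: "open U" "hol F U" and R: "R > 0"
  shows "hol (taylor_coeff F j R m) {x. \<forall>\<zeta>\<in>cball 0 R. x(j := \<zeta>) \<in> U}"
    (is "hol _ ?X")
proof -
  have sph: "path_image (circlepath 0 R) = sphere 0 R" using R by simp
  have Fc: "continuous_on U F" using U by (simp add: hol_def)
  have "hol (\<lambda>x. contour_integral (circlepath 0 R) (\<lambda>\<zeta>. F (x(j := \<zeta>)) / \<zeta> ^ Suc m)) ?X"
  proof (rule hol_contour_integral[OF open_upd_compact[OF U(1) compact_cball] C1_path_circlepath], unfold sph)
    have "continuous_on (?X \<times> sphere 0 R) (\<lambda>q. F ((fst q)(j := snd q)))"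
      by (rule continuous_on_upd_pair[OF Fc]) auto
    moreover have "continuous_on (?X \<times> sphere (0::complex) R) (\<lambda>q. snd q ^ Suc m)"
      by (intro continuous_on_power continuous_on_snd continuous_on_id)
    ultimately show "continuous_on (?X \<times> sphere 0 R) (\<lambda>(x, \<zeta>). F (x(j := \<zeta>)) / \<zeta> ^ Suc m)"
      unfolding case_prod_unfold by (rule continuous_on_divide) (use R in auto)
  next
    fix \<zeta> :: complex assume z: "\<zeta> \<in> sphere 0 R"
    have "hol (\<lambda>x. F (x(j := \<zeta>))) ?X"
      by (rule hol_subset[OF hol_upd_const[OF U(2)]]) (use z in auto)
    then show "hol (\<lambda>x. F (x(j := \<zeta>)) / \<zeta> ^ Suc m) ?X"
      by (rule hol_divide[OF _ hol_const]) (use z R in auto)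
  qed
  then show ?thesis
    unfolding taylor_coeff_def[abs_def] by (rule hol_divide[OF _ hol_const]) auto
qed

text \<open>The remainder is a Cauchy integral with kernel
  \<open>(x j / \<zeta>) ^ M / (\<zeta> - x j)\<close>, of modulus at most
  \<open>(s / R) ^ M / (R - s)\<close> on the circle; the length of the contour contributes the
  factor R.\<close>

lemma taylor_remainder:
  assumes h: "(\<lambda>t. F (x(j := t))) holomorphic_on cball 0 R" and R: "0 \<le> s" "s < R" and w: "cmod (x j) \<le> s"
    and B: "\<And>\<zeta>. \<zeta> \<in> sphere 0 R \<Longrightarrow> cmod (F (x(j := \<zeta>))) \<le> B"
  shows "cmod (F x - (\<Sum>m<M. taylor_coeff F j R m x * x j ^ m)) \<le> B * R / (R - s) * (s / R) ^ M"
proof -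
  let ?c = "circlepath 0 R"
  let ?f = "\<lambda>\<zeta>. F (x(j := \<zeta>))"
  have R0: "R > 0" using R by simp
  have sph: "path_image ?c = sphere 0 R" using R0 by simp
  have ne: "\<zeta> \<noteq> 0" "\<zeta> \<noteq> x j" if "\<zeta> \<in> sphere 0 R" for \<zeta>
    using that R0 R w by auto
  have fc: "continuous_on (sphere 0 R) ?f"
    by (rule continuous_on_subset[OF holomorphic_on_imp_continuous_on[OF h]]) auto
  have int: "(\<lambda>\<zeta>. ?f \<zeta> / \<zeta> ^ Suc m) contour_integrable_on ?c" for m
  proof (rule contour_integrable_continuous_circlepath, unfold sph)
    show "continuous_on (sphere 0 R) (\<lambda>\<zeta>. ?f \<zeta> / \<zeta> ^ Suc m)"
      by (rule continuous_on_divide[OF fc continuous_on_power[OF continuous_on_id]]) (use R0 in auto)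
  qed
  have trm: "((\<lambda>\<zeta>. ?f \<zeta> / \<zeta> ^ Suc m * x j ^ m) has_contour_integral
      (2 * of_real pi * \<i> * (taylor_coeff F j R m x * x j ^ m))) ?c" for m
  proof -
    have "((\<lambda>\<zeta>. ?f \<zeta> / \<zeta> ^ Suc m) has_contour_integral (2 * of_real pi * \<i> * taylor_coeff F j R m x)) ?c"
      using has_contour_integral_integral[OF int[of m]] by (simp add: taylor_coeff_def)
    from has_contour_integral_rmul[OF this, of "x j ^ m"] show ?thesis by (simp add: mult.assoc)
  qed
  have "((\<lambda>\<zeta>. ?f \<zeta> / (\<zeta> - x j)) has_contour_integral (2 * of_real pi * \<i> * ?f (x j))) ?c"
    by (rule Cauchy_integral_circlepath_simple[OF h]) (use w R in simp)
  then have "((\<lambda>\<zeta>. ?f \<zeta> / (\<zeta> - x j) - (\<Sum>m<M. ?f \<zeta> / \<zeta> ^ Suc m * x j ^ m)) has_contour_integral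
      (2 * of_real pi * \<i> * ?f (x j) - (\<Sum>m<M. 2 * of_real pi * \<i> * (taylor_coeff F j R m x * x j ^ m)))) ?c"
    by (intro has_contour_integral_diff has_contour_integral_sum trm) auto
  then have "((\<lambda>\<zeta>. ?f \<zeta> * ((x j / \<zeta>) ^ M / (\<zeta> - x j))) has_contour_integral
      (2 * of_real pi * \<i> * (F x - (\<Sum>m<M. taylor_coeff F j R m x * x j ^ m)))) ?c"
    unfolding fun_upd_triv sum_distrib_left[symmetric] right_diff_distrib[symmetric]
  proof (rule has_contour_integral_eq, unfold sph)
    fix \<zeta> :: complex assume z: "\<zeta> \<in> sphere 0 R"
    have "?f \<zeta> / (\<zeta> - x j) - (\<Sum>m<M. ?f \<zeta> / \<zeta> ^ Suc m * x j ^ m) =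
      ?f \<zeta> * (1 / (\<zeta> - x j) - (\<Sum>m<M. x j ^ m / \<zeta> ^ Suc m))"
      by (simp add: right_diff_distrib sum_distrib_left)
    then show "?f \<zeta> / (\<zeta> - x j) - (\<Sum>m<M. ?f \<zeta> / \<zeta> ^ Suc m * x j ^ m) = ?f \<zeta> * ((x j / \<zeta>) ^ M / (\<zeta> - x j))"
      using geometric_kernel[OF ne[OF z]] by simp
  qed
  then have "cmod (2 * of_real pi * \<i> * (F x - (\<Sum>m<M. taylor_coeff F j R m x * x j ^ m)))
      \<le> B * ((s / R) ^ M / (R - s)) * (2 * pi * R)"
  proof (rule has_contour_integral_bound_circlepath)
    have "of_real R \<in> sphere (0::complex) R" using R0 by simp
    then have B0: "0 \<le> B" using B norm_ge_zero order_trans by blast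
    then show "0 \<le> B * ((s / R) ^ M / (R - s))" using R by simp
    show "0 < R" by (rule R0)
    fix \<zeta> :: complex assume "cmod (\<zeta> - 0) = R"
    then have z: "\<zeta> \<in> sphere 0 R" "cmod \<zeta> = R" by auto
    have "R - s \<le> cmod (\<zeta> - x j)" using norm_triangle_ineq2[of \<zeta> "x j"] z w by linarith
    moreover have "cmod ((x j / \<zeta>) ^ M) \<le> (s / R) ^ M"
      using w z R0 by (simp add: norm_power norm_divide power_mono divide_right_mono)
    ultimately have "cmod ((x j / \<zeta>) ^ M / (\<zeta> - x j)) \<le> (s / R) ^ M / (R - s)"
      unfolding norm_divide[of "(x j / \<zeta>) ^ M"] using R by (intro frac_le) auto
    then show "cmod (?f \<zeta> * ((x j / \<zeta>) ^ M / (\<zeta> - x j))) \<le> B * ((s / R) ^ M / (R - s))"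
      unfolding norm_mult using B[OF z(1)] B0 by (intro mult_mono) auto
  qed
  also have "cmod (2 * of_real pi * \<i> * (F x - (\<Sum>m<M. taylor_coeff F j R m x * x j ^ m))) =
      2 * pi * cmod (F x - (\<Sum>m<M. taylor_coeff F j R m x * x j ^ m))"
    by (simp add: norm_mult)
  also have "B * ((s / R) ^ M / (R - s)) * (2 * pi * R) = 2 * pi * (B * R / (R - s) * (s / R) ^ M)"
    by simp
  finally show ?thesis by (rule mult_left_le_imp_le) simp
qed

text \<open>Induction on the number of non-degenerate coordinates: Taylor expansion in the last one,
  then approximation of finitely many coefficients on the polydisc with that radius set to 0. The
  gap between \<sigma> and \<rho> makes the expansion converge uniformly.\<close>

theorem polydisc_approximation:
  assumes "open U" "hol F U" "polydisc \<rho> \<subseteq> U" "\<And>i. N \<le> i \<Longrightarrow> \<rho> i = 0"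
    and "\<And>i. i < N \<Longrightarrow> 0 \<le> \<sigma> i \<and> \<sigma> i < \<rho> i" "\<And>i. N \<le> i \<Longrightarrow> \<sigma> i = 0" "\<epsilon> > 0"
  shows "\<exists>P\<in>pol. \<forall>x\<in>polydisc \<sigma>. cmod (F x - P x) < \<epsilon>"
  using assms
proof (induction N arbitrary: U F \<rho> \<sigma> \<epsilon>)
  case 0
  have "x = (\<lambda>i. 0)" if "x \<in> polydisc \<sigma>" for x
    using that 0 by (auto simp: polydisc_def)
  then have "\<forall>x\<in>polydisc \<sigma>. cmod (F x - F (\<lambda>i. 0)) < \<epsilon>" using 0 by auto
  then show ?case using pol_const by (intro bexI[of _ "\<lambda>x. F (\<lambda>i. 0)"])
next
  case (Suc N)
  define R s where "R = \<rho> N" and "s = \<sigma> N"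
  have R: "0 \<le> s" "s < R" "R > 0" using Suc.prems(5)[of N] by (auto simp: R_def s_def)
  let ?X = "{x. \<forall>\<zeta>\<in>cball 0 R. x(N := \<zeta>) \<in> U}"
  let ?c = "taylor_coeff F N R"
  have "bounded (F ` polydisc \<rho>)"
    using Suc.prems(2,3) compact_polydisc[of \<rho>]
    by (intro compact_imp_bounded compact_continuous_image) (auto simp: hol_def intro: continuous_on_subset)
  then obtain B where B: "B > 0" "\<And>x. x \<in> polydisc \<rho> \<Longrightarrow> cmod (F x) \<le> B"
    unfolding bounded_pos by auto
  have pd: "x(N := \<zeta>) \<in> polydisc \<rho>" if "x \<in> polydisc \<sigma>" "\<zeta> \<in> cball 0 R" for x \<zeta>
  proof -
    have "\<sigma> i \<le> \<rho> i" for i using Suc.prems(4,5,6)[of i] by (cases "i < Suc N") auto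
    then show ?thesis using that by (auto simp: polydisc_def R_def intro: order_trans)
  qed
  have C: "B * R / (R - s) > 0" using B R by simp
  obtain M where M: "(s / R) ^ M < \<epsilon> / 2 / (B * R / (R - s))"
    using real_arch_pow_inv[of "\<epsilon> / 2 / (B * R / (R - s))" "s / R"] R B Suc.prems(7) by auto
  have rem: "cmod (F x - (\<Sum>m<M. ?c m x * x N ^ m)) < \<epsilon> / 2" if x: "x \<in> polydisc \<sigma>" for x
  proof -
    have "cmod (F x - (\<Sum>m<M. ?c m x * x N ^ m)) \<le> B * R / (R - s) * (s / R) ^ M"
    proof (rule taylor_remainder[OF _ R(1,2)])
      show "(\<lambda>t. F (x(N := t))) holomorphic_on cball 0 R"
        by (rule holomorphic_on_subset[OF hol_slice[OF Suc.prems(2)]]) (use pd x Suc.prems(3) in auto)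
      show "cmod (x N) \<le> s" using x by (auto simp: polydisc_def s_def)
      show "cmod (F (x(N := \<zeta>))) \<le> B" if "\<zeta> \<in> sphere 0 R" for \<zeta>
        using B pd x that by auto
    qed
    also have "\<dots> < \<epsilon> / 2" using M unfolding pos_less_divide_eq[OF C] by (simp only: mult.commute)
    finally show ?thesis .
  qed
  \<comment> \<open>The coefficient errors add up to at most \<delta> times the sum of the
    \<open>s ^ m\<close>; the extra 1 makes the bound \<epsilon> / 2 strict and covers an empty
    sum.\<close>
  define \<delta> where "\<delta> = \<epsilon> / 2 / ((\<Sum>m<M. s ^ m) + 1)"
  have S0: "0 \<le> (\<Sum>m<M. s ^ m)" using R by (intro sum_nonneg) auto
  have d: "\<delta> > 0" using S0 Suc.prems(7) by (simp add: \<delta>_def)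
  have "\<exists>P\<in>pol. \<forall>x\<in>polydisc (\<sigma>(N := 0)). cmod (?c m x - P x) < \<delta>" for m
  proof (rule Suc.IH[where \<rho> = "\<rho>(N := 0)"])
    show "open ?X" by (rule open_upd_compact[OF Suc.prems(1) compact_cball])
    show "hol (?c m) ?X" by (rule hol_taylor_coeff[OF Suc.prems(1,2) R(3)])
    have "x(N := \<zeta>) \<in> polydisc \<rho>" if "x \<in> polydisc (\<rho>(N := 0))" "\<zeta> \<in> cball 0 R" for x \<zeta>
      using that by (auto simp: polydisc_def R_def split: if_splits)
    then show "polydisc (\<rho>(N := 0)) \<subseteq> ?X" using Suc.prems(3) by blast
  qed (use Suc.prems d in auto)
  then obtain P where P: "\<And>m. P m \<in> pol" "\<And>m x. x \<in> polydisc (\<sigma>(N := 0)) \<Longrightarrow> cmod (?c m x - P m x) < \<delta>"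
    by metis
  \<comment> \<open>Setting \<open>x N\<close> to 0 leaves the Taylor coefficients unchanged and
    moves x into the smaller polydisc on which P was chosen.\<close>
  let ?Q = "\<lambda>x. \<Sum>m<M. P m (x(N := 0)) * x N ^ m"
  have "?Q \<in> pol" by (intro pol_sum pol_mult pol_upd_const pol_power pol_coord P)
  moreover have "cmod (F x - ?Q x) < \<epsilon>" if x: "x \<in> polydisc \<sigma>" for x
  proof -
    have x0: "x(N := 0) \<in> polydisc (\<sigma>(N := 0))" using x by (auto simp: polydisc_def)
    have "cmod ((\<Sum>m<M. ?c m x * x N ^ m) - ?Q x) = cmod (\<Sum>m<M. (?c m (x(N := 0)) - P m (x(N := 0))) * x N ^ m)"
      by (simp add: sum_subtractf left_diff_distrib)
    also have "\<dots> \<le> (\<Sum>m<M. \<delta> * s ^ m)"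
    proof (rule order_trans[OF norm_sum sum_mono])
      fix m
      have "cmod (x N) \<le> s" using x by (auto simp: polydisc_def s_def)
      then show "cmod ((?c m (x(N := 0)) - P m (x(N := 0))) * x N ^ m) \<le> \<delta> * s ^ m"
        unfolding norm_mult norm_power using P(2)[OF x0, of m] d
        by (intro mult_mono power_mono) auto
    qed
    also have "\<dots> = \<delta> * (\<Sum>m<M. s ^ m)" by (simp add: sum_distrib_left)
    also have "\<dots> < \<epsilon> / 2"
      using S0 Suc.prems(7) by (simp add: \<delta>_def pos_divide_less_eq)
    finally show ?thesis
      using rem[OF x] norm_triangle_ineq[of "F x - (\<Sum>m<M. ?c m x * x N ^ m)" "(\<Sum>m<M. ?c m x * x N ^ m) - ?Q x"]
      by simp
  qed
  ultimately show ?case by (intro bexI[of _ ?Q] ballI)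
qed

section \<open>The Oka--Weil theorem\<close>

text \<open>A general index set may repeat multi-indices; collecting equal exponents once here lets
  sums and products be written term by term.\<close>

lemma complex_polynomialI:
  fixes \<alpha> :: "'s \<Rightarrow> 'n::finite \<Rightarrow> nat"
  assumes "finite S" "\<And>z. q z = (\<Sum>s\<in>S. c s * (\<Prod>i\<in>UNIV. (z $ i) ^ \<alpha> s i))"
  shows "complex_polynomial q"
  unfolding complex_polynomial_def
proof (intro exI conjI allI)
  show "finite (\<alpha> ` S)" using assms(1) by simp
  fix z
  have "q z = (\<Sum>\<beta>\<in>\<alpha> ` S. \<Sum>s\<in>{s \<in> S. \<alpha> s = \<beta>}. c s * (\<Prod>i\<in>UNIV. (z $ i) ^ \<alpha> s i))"
    unfolding assms(2) by (rule sum.image_gen[OF assms(1)])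
  also have "\<dots> = (\<Sum>\<beta>\<in>\<alpha> ` S. (\<Sum>s\<in>{s \<in> S. \<alpha> s = \<beta>}. c s) * (\<Prod>i\<in>UNIV. (z $ i) ^ \<beta> i))"
    by (simp add: sum_distrib_right)
  finally show "q z = (\<Sum>\<beta>\<in>\<alpha> ` S. (\<Sum>s\<in>{s \<in> S. \<alpha> s = \<beta>}. c s) * (\<Prod>i\<in>UNIV. (z $ i) ^ \<beta> i))" .
qed

lemma complex_polynomialE:
  assumes "complex_polynomial q"
  obtains A c where "finite A" "\<And>z. q z = (\<Sum>\<alpha>\<in>A. c \<alpha> * (\<Prod>i\<in>UNIV. (z $ i) ^ \<alpha> i))"
  using assms unfolding complex_polynomial_def by (elim exE conjE) (rule that, simp_all)

lemma complex_polynomial_monomial: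
  "complex_polynomial (\<lambda>z. c * (\<Prod>i\<in>UNIV. (z $ i) ^ \<alpha> i))"
  by (rule complex_polynomialI[of "{()}" _ "\<lambda>_. c" "\<lambda>_. \<alpha>"]) auto

lemma complex_polynomial_const: "complex_polynomial (\<lambda>z. c)"
  using complex_polynomial_monomial[of c "\<lambda>_. 0"] by simp

lemma complex_polynomial_coord: "complex_polynomial (\<lambda>z::complex^'n. z $ k)"
proof -
  have "(\<Prod>i\<in>UNIV. (z $ i) ^ (if i = k then 1 else 0)) = z $ k" for z :: "complex^'n"
    by (simp add: if_distrib[of "power _"] prod.delta cong: if_cong)
  then show ?thesis using complex_polynomial_monomial[of 1 "\<lambda>i. if i = k then 1 else 0"] by simp
qed

lemma complex_polynomial_add:
  assumes "complex_polynomial p" "complex_polynomial q"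
  shows "complex_polynomial (\<lambda>z. p z + q z)"
proof -
  obtain A c where A: "finite A" "\<And>z. p z = (\<Sum>\<alpha>\<in>A. c \<alpha> * (\<Prod>i\<in>UNIV. (z $ i) ^ \<alpha> i))"
    by (rule complex_polynomialE[OF assms(1)]) (rule that)
  obtain B d where B: "finite B" "\<And>z. q z = (\<Sum>\<alpha>\<in>B. d \<alpha> * (\<Prod>i\<in>UNIV. (z $ i) ^ \<alpha> i))"
    by (rule complex_polynomialE[OF assms(2)]) (rule that)
  show ?thesis
    by (rule complex_polynomialI[of "A <+> B" _ "case_sum c d" "case_sum id id"])
      (simp_all add: A B sum.Plus)
qed

lemma complex_polynomial_mult:
  assumes "complex_polynomial p" "complex_polynomial q"
  shows "complex_polynomial (\<lambda>z. p z * q z)"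
proof -
  obtain A c where A: "finite A" "\<And>z. p z = (\<Sum>\<alpha>\<in>A. c \<alpha> * (\<Prod>i\<in>UNIV. (z $ i) ^ \<alpha> i))"
    by (rule complex_polynomialE[OF assms(1)]) (rule that)
  obtain B d where B: "finite B" "\<And>z. q z = (\<Sum>\<alpha>\<in>B. d \<alpha> * (\<Prod>i\<in>UNIV. (z $ i) ^ \<alpha> i))"
    by (rule complex_polynomialE[OF assms(2)]) (rule that)
  show ?thesis
  proof (rule complex_polynomialI[of "A \<times> B" _ "\<lambda>(\<alpha>, \<beta>). c \<alpha> * d \<beta>" "\<lambda>(\<alpha>, \<beta>) i. \<alpha> i + \<beta> i"])
    show "p z * q z = (\<Sum>s\<in>A \<times> B. (case s of (\<alpha>, \<beta>) \<Rightarrow> c \<alpha> * d \<beta>) *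
        (\<Prod>i\<in>UNIV. (z $ i) ^ (case s of (\<alpha>, \<beta>) \<Rightarrow> \<lambda>i. \<alpha> i + \<beta> i) i))" for z
      unfolding A B sum_product sum.cartesian_product
      by (intro sum.cong) (auto simp: power_add prod.distrib)
  qed (use A B in simp)
qed

lemma complex_polynomial_power: "complex_polynomial p \<Longrightarrow> complex_polynomial (\<lambda>z. p z ^ k)"
  by (induction k) (simp_all add: complex_polynomial_const complex_polynomial_mult)

lemma complex_polynomial_pol:
  assumes "P \<in> pol" "\<And>k. complex_polynomial (g k)"
  shows "complex_polynomial (\<lambda>z. P (\<lambda>k. g k z))"
  using assms(1)
  by (induction rule: pol.induct)
    (simp_all add: assms(2) complex_polynomial_const complex_polynomial_add complex_polynomial_mult)

lemma continuous_on_complex_polynomial: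
  assumes "complex_polynomial q" shows "continuous_on S q"
proof -
  obtain A c where A: "\<And>z. q z = (\<Sum>\<alpha>\<in>A. c \<alpha> * (\<Prod>i\<in>UNIV. (z $ i) ^ \<alpha> i))"
    by (rule complex_polynomialE[OF assms]) (rule that)
  have "continuous_on S (\<lambda>z. \<Sum>\<alpha>\<in>A. c \<alpha> * (\<Prod>i\<in>UNIV. (z $ i) ^ \<alpha> i))"
    by (intro continuous_intros)
  then show ?thesis unfolding A[symmetric] .
qed

section \<open>Transfer from \<open>complex^'n\<close> to sequences of coordinates\<close>

lemma hol_prod: "(\<And>i. i \<in> I \<Longrightarrow> hol (F i) U) \<Longrightarrow> hol (\<lambda>x. \<Prod>i\<in>I. F i x) U"
  by (induction I rule: infinite_finite_induct) (simp_all add: hol_mult)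

lemma hol_complex_polynomial:
  assumes "complex_polynomial q" shows "hol (\<lambda>x. q (\<chi> i. x (e i))) U"
proof -
  obtain A c where A: "\<And>z. q z = (\<Sum>\<alpha>\<in>A. c \<alpha> * (\<Prod>i\<in>UNIV. (z $ i) ^ \<alpha> i))"
    by (rule complex_polynomialE[OF assms]) (rule that)
  show ?thesis unfolding A vec_lambda_beta
    by (intro hol_sum hol_mult hol_const hol_prod hol_power hol_coord)
qed

lemma continuous_on_decode: "continuous_on S (\<lambda>x. \<chi> i::'n::finite. (x (e i) :: complex))"
  by (intro continuous_on_vec_lambda continuous_on_coordinate)

lemma open_decode: "open U \<Longrightarrow> open {x. (\<chi> i::'n::finite. (x (e i) :: complex)) \<in> U}"
  using open_vimage[OF _ continuous_on_decode, of U e] by (simp add: vimage_def)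

text \<open>By injectivity of e, changing one coordinate moves the argument of h along at most one
  axis. Complex linearity of D turns the real derivative along that axis into multiplication by
  \<open>D (axis k 1)\<close>.\<close>

lemma hol_holomorphic_several:
  fixes e :: "'n::finite \<Rightarrow> nat"
  assumes "inj e" "holomorphic_several h U"
  shows "hol (\<lambda>x. h (\<chi> i. x (e i))) {x. (\<chi> i. x (e i)) \<in> U}"
  unfolding hol_def
proof (intro conjI ballI allI)
  have "continuous_on U h"
    using assms(2) unfolding holomorphic_several_def
    by (meson continuous_at_imp_continuous_on has_derivative_continuous)
  then show "continuous_on {x. (\<chi> i. x (e i)) \<in> U} (\<lambda>x. h (\<chi> i. x (e i)))"
    by (rule continuous_on_compose2[OF _ continuous_on_decode]) auto
next
  fix x i assume x: "x \<in> {x. (\<chi> i. x (e i)) \<in> U}"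
  show "(\<lambda>t. h (\<chi> k. (x(i := t)) (e k))) field_differentiable at (x i)"
  proof (cases "i \<in> range e")
    case True
    then obtain k where k: "i = e k" by blast
    obtain D where D: "(h has_derivative D) (at (\<chi> k. x (e k)))" "\<And>c v. D (c *s v) = c * D v"
      using assms(2) x unfolding holomorphic_several_def by blast
    let ?\<phi> = "\<lambda>t. (\<chi> j. x (e j)) + axis k (t - x i)"
    have phi: "(\<chi> j. (x(i := t)) (e j)) = ?\<phi> t" for t
      using assms(1) by (auto simp: vec_eq_iff axis_def k inj_eq)
    have "linear (axis k :: complex \<Rightarrow> complex^'n)"
      by (rule linearI) (auto simp: vec_eq_iff axis_def)
    then have bl: "bounded_linear (axis k :: complex \<Rightarrow> complex^'n)" by (simp add: linear_linear)
    have d\<phi>: "(?\<phi> has_derivative (\<lambda>s. 0 + axis k (s - 0))) (at (x i))"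
      by (intro has_derivative_add has_derivative_const bounded_linear.has_derivative[OF bl]
          has_derivative_diff has_derivative_ident)
    have "axis k (0::complex) = 0" by (simp add: vec_eq_iff axis_def)
    then have eq: "?\<phi> (x i) = (\<chi> j. x (e j))" by simp
    have "((\<lambda>t. h (?\<phi> t)) has_derivative (\<lambda>s. D (0 + axis k (s - 0)))) (at (x i))"
      by (rule has_derivative_compose[OF d\<phi>]) (unfold eq, rule D(1))
    moreover have "D (0 + axis k (s - 0)) = D (axis k 1) * s" for s
    proof -
      have "0 + axis k (s - 0) = s *s axis k (1::complex)" by (auto simp: vec_eq_iff axis_def)
      then show ?thesis by (simp only: D(2) mult.commute)
    qed
    ultimately have "((\<lambda>t. h (?\<phi> t)) has_field_derivative D (axis k 1)) (at (x i))"
      by (simp only: has_field_derivative_def)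
    then show ?thesis unfolding phi by (auto simp only: field_differentiable_def)
  next
    case False
    then have "(x(i := t)) (e k) = x (e k)" for t k by auto
    then show ?thesis by simp
  qed
qed

lemma cmod_le_sup_norm_on:
  assumes "compact Q" "continuous_on Q q" "z \<in> Q"
  shows "cmod (q z) \<le> sup_norm_on Q q"
proof -
  have "compact ((\<lambda>z. cmod (q z)) ` Q)"
    by (intro compact_continuous_image continuous_on_norm assms)
  then have "bdd_above ((\<lambda>z. cmod (q z)) ` Q)"
    by (rule bounded_imp_bdd_above[OF compact_imp_bounded])
  then show ?thesis unfolding sup_norm_on_def using assms(3) by (intro cSUP_upper) auto
qed

text \<open>A polynomial that exceeds its norm on Q at z is divided by some b in between and raised
  to a power, which makes the ratio arbitrarily large; a ratio of 4 gives the thresholds 1/2 and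
  2.\<close>

lemma separating_polynomial:
  fixes Q :: "(complex^'n) set"
  assumes Q: "compact Q" "Q \<noteq> {}" and z: "z \<notin> polynomial_hull Q"
  obtains q where "complex_polynomial q" "\<And>x. x \<in> Q \<Longrightarrow> cmod (q x) \<le> 1/2" "2 < cmod (q z)"
proof -
  obtain q where q: "complex_polynomial q" "sup_norm_on Q q < cmod (q z)"
    using z by (auto simp: polynomial_hull_def not_le)
  have le: "cmod (q x) \<le> sup_norm_on Q q" if "x \<in> Q" for x
    by (rule cmod_le_sup_norm_on[OF Q(1) continuous_on_complex_polynomial[OF q(1)] that])
  have "0 \<le> sup_norm_on Q q" using le Q(2) norm_ge_zero order_trans by (metis ex_in_conv)
  then obtain b where b: "sup_norm_on Q q < b" "b < cmod (q z)" "0 < b" using dense[OF q(2)] by auto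
  obtain k where k: "4 < (cmod (q z) / b) ^ k" using real_arch_pow[of "cmod (q z) / b" 4] b by auto
  let ?q = "\<lambda>x. 1/2 * (1 / of_real b * q x) ^ k"
  have n: "cmod (?q x) = 1/2 * (cmod (q x) / b) ^ k" for x
    using b by (simp add: norm_mult norm_power norm_divide power_divide)
  show ?thesis
  proof
    show "complex_polynomial ?q"
      by (intro complex_polynomial_mult complex_polynomial_const complex_polynomial_power q)
    show "cmod (?q x) \<le> 1/2" if "x \<in> Q" for x
    proof -
      have "cmod (q x) / b \<le> 1" using le[OF that] b by simp
      then have "(cmod (q x) / b) ^ k \<le> 1" using b by (intro power_le_one) auto
      then show ?thesis unfolding n by simp
    qed
    show "2 < cmod (?q z)" unfolding n using k by simp
  qed
qed

theorem Oka_Weil: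
  fixes Q :: "(complex^'n) set"
  assumes Q: "compact Q" "Q \<noteq> {}" "Q = polynomial_hull Q"
    and g: "holomorphic_near g Q" and \<epsilon>: "0 < \<epsilon>"
  obtains q where "complex_polynomial q" "\<And>z. z \<in> Q \<Longrightarrow> cmod (q z - g z) < \<epsilon>"
proof -
  obtain U h where U: "open U" "Q \<subseteq> U" "holomorphic_several h U" "\<And>z. z \<in> Q \<Longrightarrow> g z = h z"
    using g unfolding holomorphic_near_def by auto
  obtain R where R: "R > 0" "\<And>z. z \<in> Q \<Longrightarrow> norm z \<le> R"
    using compact_imp_bounded[OF Q(1)] unfolding bounded_pos by blast
  \<comment> \<open>A cube with margin 1 around Q. Only its part outside U has to be excluded by
    polynomial inequalities, and that part is compact.\<close>
  define C :: "(complex^'n) set" where "C = {z. \<forall>i. z $ i \<in> cbox (Complex (- R - 1) (- R - 1)) (Complex (R + 1) (R + 1))}"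
  have "compact C"
  proof (rule compact_eq_bounded_closed[THEN iffD2], intro conjI)
    have "norm z \<le> (\<Sum>i\<in>(UNIV::'n set). 2 * (R + 1))" if "z \<in> C" for z
    proof -
      have "norm z \<le> (\<Sum>i\<in>UNIV. cmod (z $ i))"
        unfolding norm_vec_def by (rule L2_set_le_sum) simp
      also have "\<dots> \<le> (\<Sum>i\<in>(UNIV::'n set). 2 * (R + 1))"
      proof (rule sum_mono)
        fix i
        have zi: "z $ i \<in> cbox (Complex (- R - 1) (- R - 1)) (Complex (R + 1) (R + 1))"
          using that by (simp add: C_def)
        have "cmod (z $ i) \<le> \<bar>Re (z $ i)\<bar> + \<bar>Im (z $ i)\<bar>" by (rule cmod_le)
        also have "\<dots> \<le> (R + 1) + (R + 1)"
          using zi by (intro add_mono) (auto simp: in_cbox_complex_iff abs_if)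
        finally show "cmod (z $ i) \<le> 2 * (R + 1)" by simp
      qed
      finally show ?thesis .
    qed
    then show "bounded C" unfolding bounded_iff by blast
    have "C = (\<Inter>i. {z. z $ i \<in> cbox (Complex (- R - 1) (- R - 1)) (Complex (R + 1) (R + 1))})"
      by (auto simp: C_def)
    also have "closed \<dots>"
      by (intro closed_INT ballI closed_vimage[unfolded vimage_def] closed_cbox continuous_intros)
    finally show "closed C" .
  qed
  then have CU: "compact (C - U)" using U(1) by (rule compact_diff)
  define \<Q> where "\<Q> = {q. complex_polynomial q \<and> (\<forall>x\<in>Q. cmod (q x) \<le> 1/2)}"
  have "C - U \<subseteq> (\<Union>q\<in>\<Q>. {z. 2 < cmod (q z)})"
  proof
    fix z assume "z \<in> C - U"
    then have "z \<notin> polynomial_hull Q" using U(2) Q(3) by blast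
    then obtain q where "complex_polynomial q" "\<And>x. x \<in> Q \<Longrightarrow> cmod (q x) \<le> 1/2" "2 < cmod (q z)"
      by (rule separating_polynomial[OF Q(1,2)]) (rule that)
    then show "z \<in> (\<Union>q\<in>\<Q>. {z. 2 < cmod (q z)})" by (auto simp: \<Q>_def)
  qed
  moreover have "open {z. 2 < cmod (q z)}" if "q \<in> \<Q>" for q
    by (intro open_Collect_less continuous_on_const continuous_on_norm continuous_on_complex_polynomial)
      (use that in \<open>simp add: \<Q>_def\<close>)
  ultimately obtain D where D: "D \<subseteq> \<Q>" "finite D" "C - U \<subseteq> (\<Union>q\<in>D. {z. 2 < cmod (q z)})"
    using compactE_image[OF CU, of \<Q> "\<lambda>q. {z. 2 < cmod (q z)}"] by blast
  define n k where "n = CARD('n)" and "k = card D"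
  \<comment> \<open>Sequence coordinates below n carry z, the next k carry the values of the
    polynomials in D, and all later ones are 0.\<close>
  obtain e :: "'n \<Rightarrow> nat" where e: "bij_betw e UNIV {0..<n}"
    using ex_bij_betw_finite_nat[of "UNIV :: 'n set"] by (auto simp: n_def)
  have e_lt: "e i < n" for i using bij_betwE[OF e] by auto
  have inj_e: "inj e" using e by (rule bij_betw_imp_inj_on)
  obtain d where d: "bij_betw d {0..<k} D"
    using ex_bij_betw_nat_finite[OF D(2)] by (auto simp: k_def)
  have dD: "d (j - n) \<in> D" if "n \<le> j" "j < n + k" for j
    using that bij_betwE[OF d] by auto
  define dec :: "(nat \<Rightarrow> complex) \<Rightarrow> complex^'n" where "dec x = (\<chi> i. x (e i))" for x
  define J where "J = {n..<n + k}"
  define p where "p j x = d (j - n) (dec x)" for j x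
  have dec_upd: "dec (x(j := t)) = dec x" if "j \<in> J" for x j t
    using e_lt that by (auto simp: dec_def J_def vec_eq_iff) (metis leD)
  have polyD: "complex_polynomial q" if "q \<in> D" for q using that D(1) by (auto simp: \<Q>_def)
  have loc: "graph_equations p J"
  proof
    show "finite J" by (simp add: J_def)
    show "hol (p j) UNIV" if "j \<in> J" for j
      unfolding p_def[abs_def] dec_def
      by (rule hol_complex_polynomial[OF polyD[OF dD]]) (use that in \<open>auto simp: J_def\<close>)
    show "p j (x(i := t)) = p j x" if "i \<in> J" for i j x t
      unfolding p_def dec_upd[OF that] ..
  qed
  let ?gr = "graph_equations.gr p"
  note gr_def = graph_equations.gr_def[OF loc] and ext_def = graph_equations.extendable_def[OF loc]
  \<comment> \<open>Half-sides of the box and outer radii at once; the zeros make all but finitely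
    many sides degenerate.\<close>
  define \<rho> where "\<rho> i = (if i < n then R + 1 else if i < n + k then 1 else 0)" for i
  define a b where "a i = Complex (- \<rho> i) (- \<rho> i)" and "b i = Complex (\<rho> i) (\<rho> i)" for i
  have "finite {i. a i \<noteq> b i}"
    by (rule finite_subset[of _ "{..<n + k}"]) (auto simp: a_def b_def \<rho>_def)
  then have ok: "box_ok a b"
    using R(1) by (auto simp: box_ok_def cbox_complex_ne_iff a_def b_def \<rho>_def)
  have oU: "open {x. dec x \<in> U}" unfolding dec_def by (rule open_decode[OF U(1)])
  have hU: "hol (\<lambda>x. h (dec x)) {x. dec x \<in> U}"
    unfolding dec_def by (rule hol_holomorphic_several[OF inj_e U(3)])
  \<comment> \<open>A graph point over \<open>C - U\<close> would have a coordinate of modulus above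
    2, whereas a square of half-side 1 allows at most 2.\<close>
  have "Box a b \<inter> ?gr J \<subseteq> {x. dec x \<in> U}"
  proof (rule ccontr)
    assume "\<not> ?thesis"
    then obtain x where x: "x \<in> Box a b" "x \<in> ?gr J" "dec x \<notin> U" by blast
    have "x (e i) \<in> cbox (a (e i)) (b (e i))" for i using x(1) by (simp add: Box_def)
    then have "dec x \<in> C"
      using e_lt by (simp add: C_def dec_def a_def b_def \<rho>_def)
    then obtain q where q: "q \<in> D" "2 < cmod (q (dec x))" using D(3) x(3) by blast
    obtain l where l: "l < k" "q = d l" using d q(1) by (auto simp: bij_betw_def)
    have "n + l \<in> J" using l by (simp add: J_def)
    then have xl: "x (n + l) = q (dec x)" using x(2) l by (auto simp: gr_def p_def)
    have "x (n + l) \<in> cbox (a (n + l)) (b (n + l))" using x(1) by (simp add: Box_def)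
    then have "\<bar>Re (x (n + l))\<bar> \<le> 1" "\<bar>Im (x (n + l))\<bar> \<le> 1"
      using l by (auto simp: a_def b_def \<rho>_def in_cbox_complex_iff)
    then have "cmod (x (n + l)) \<le> 2" using cmod_le[of "x (n + l)"] by linarith
    then show False using q(2) xl by simp
  qed
  from graph_equations.graph_extension[OF loc order_refl ok oU hU this]
  obtain W F V where W: "open W" "hol F W" "Box a b \<subseteq> W" "Box a b \<inter> ?gr J \<subseteq> V"
    "\<And>x. x \<in> V \<inter> ?gr J \<Longrightarrow> F x = h (dec x)"
    unfolding ext_def by (auto simp: gr_def)
  \<comment> \<open>Radii strictly below \<rho> in the first n + k coordinates, still large enough
    for the graph over Q.\<close>
  define \<sigma> where "\<sigma> i = (if i < n then R else if i < n + k then 1/2 else 0)" for i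
  have disc_box: "polydisc \<rho> \<subseteq> Box a b"
  proof
    fix x assume x: "x \<in> polydisc \<rho>"
    have "\<bar>Re (x i)\<bar> \<le> \<rho> i" "\<bar>Im (x i)\<bar> \<le> \<rho> i" for i
      using x abs_Re_le_cmod[of "x i"] abs_Im_le_cmod[of "x i"] by (auto simp: polydisc_def intro: order_trans)
    then show "x \<in> Box a b" by (simp add: Box_def in_cbox_complex_iff a_def b_def abs_le_iff minus_le_iff)
  qed
  have "\<exists>P\<in>pol. \<forall>x\<in>polydisc \<sigma>. cmod (F x - P x) < \<epsilon>"
    by (rule polydisc_approximation[OF W(1,2), of \<rho> "n + k"])
      (use disc_box W(3) R(1) \<epsilon> in \<open>auto simp: \<rho>_def \<sigma>_def\<close>)
  then obtain P where P: "P \<in> pol" "\<And>x. x \<in> polydisc \<sigma> \<Longrightarrow> cmod (F x - P x) < \<epsilon>" by blast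
  define enc where "enc i = (if i < n then (\<lambda>z. z $ inv e i) else if i < n + k then d (i - n) else (\<lambda>z. 0))" for i
  have "complex_polynomial (enc i)" for i
    using polyD[OF dD[of i]]
    by (auto simp: enc_def complex_polynomial_const complex_polynomial_coord)
  then have "complex_polynomial (\<lambda>z. P (\<lambda>i. enc i z))" by (intro complex_polynomial_pol[OF P(1)])
  moreover have "cmod (P (\<lambda>i. enc i z) - g z) < \<epsilon>" if z: "z \<in> Q" for z
  proof -
    let ?x = "\<lambda>i. enc i z"
    have dec: "dec ?x = z"
      using e_lt inj_e by (simp add: dec_def enc_def vec_eq_iff)
    have "cmod (z $ j) \<le> R" for j using Finite_Cartesian_Product.norm_nth_le[of z j] R(2)[OF z] by linarith
    moreover have "cmod (d (i - n) z) \<le> 1/2" if "n \<le> i" "i < n + k" for i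
      using dD[OF that] D(1) z by (auto simp: \<Q>_def)
    ultimately have xs: "?x \<in> polydisc \<sigma>" by (auto simp: polydisc_def enc_def \<sigma>_def)
    have "\<sigma> i \<le> \<rho> i" for i by (simp add: \<sigma>_def \<rho>_def)
    moreover have "cmod (?x i) \<le> \<sigma> i" for i using xs unfolding polydisc_def by blast
    ultimately have "cmod (?x i) \<le> \<rho> i" for i using order_trans by blast
    then have "?x \<in> polydisc \<rho>" unfolding polydisc_def by blast
    then have "?x \<in> Box a b" using disc_box by blast
    moreover have "?x j = p j ?x" if "j \<in> J" for j
      using that unfolding p_def dec by (auto simp: J_def enc_def)
    then have "?x \<in> ?gr J" unfolding gr_def by blast
    ultimately have "F ?x = h z" using W(4,5) dec by auto
    then show ?thesis using P(2)[OF xs] U(4)[OF z] by (simp add: norm_minus_commute)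
  qed
  ultimately show ?thesis by (rule that)
qed

section \<open>Measurable choice of the polynomial\<close>

text \<open>Coefficient lists form a countable type, so \<open>from_nat\<close> enumerates all these
  polynomials.\<close>

fun rational_polynomial :: "(('n::finite \<Rightarrow> nat) \<times> rat \<times> rat) list \<Rightarrow> complex^'n \<Rightarrow> complex" where
  "rational_polynomial [] z = 0"
| "rational_polynomial ((\<alpha>, u, v) # L) z =
     Complex (of_rat u) (of_rat v) * (\<Prod>i\<in>UNIV. (z $ i) ^ \<alpha> i) + rational_polynomial L z"

lemma complex_polynomial_rational: "complex_polynomial (rational_polynomial L)"
proof (induction L)
  case Nil
  have "rational_polynomial [] = (\<lambda>z. 0)" by (simp add: fun_eq_iff)
  then show ?case using complex_polynomial_const[of 0] by simp
next
  case (Cons a L)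
  obtain \<alpha> u v where a: "a = (\<alpha>, u, v)" by (cases a)
  have "rational_polynomial (a # L) =
      (\<lambda>z. Complex (of_rat u) (of_rat v) * (\<Prod>i\<in>UNIV. (z $ i) ^ \<alpha> i) + rational_polynomial L z)"
    by (simp add: a fun_eq_iff)
  then show ?case
    using complex_polynomial_add[OF complex_polynomial_monomial Cons] by simp
qed

lemma complex_rational_approx:
  assumes "\<eta> > 0"
  obtains u v where "cmod (Complex (of_rat u) (of_rat v) - c) < \<eta>"
proof -
  obtain u where u: "Re c < of_rat u" "of_rat u < Re c + \<eta> / 2"
    using of_rat_dense[of "Re c" "Re c + \<eta> / 2"] assms by auto
  obtain v where v: "Im c < of_rat v" "of_rat v < Im c + \<eta> / 2"
    using of_rat_dense[of "Im c" "Im c + \<eta> / 2"] assms by auto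
  have "cmod (Complex (of_rat u) (of_rat v) - c) \<le>
      \<bar>Re (Complex (of_rat u) (of_rat v) - c)\<bar> + \<bar>Im (Complex (of_rat u) (of_rat v) - c)\<bar>"
    by (rule cmod_le)
  also have "\<dots> < \<eta>" using u v by simp
  finally show ?thesis by (rule that)
qed

lemma rational_polynomial_dense:
  fixes Q :: "(complex^'n) set"
  assumes Q: "compact Q" and q: "complex_polynomial q" and \<epsilon>: "0 < \<epsilon>"
  obtains L where "\<And>z. z \<in> Q \<Longrightarrow> cmod (rational_polynomial L z - q z) < \<epsilon>"
proof -
  obtain A c where A: "finite A" "\<And>z. q z = (\<Sum>\<alpha>\<in>A. c \<alpha> * (\<Prod>i\<in>UNIV. (z $ i) ^ \<alpha> i))"
    by (rule complex_polynomialE[OF q]) (rule that)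
  have "\<exists>L. \<forall>z\<in>Q. cmod (rational_polynomial L z - (\<Sum>\<alpha>\<in>A. c \<alpha> * (\<Prod>i\<in>UNIV. (z $ i) ^ \<alpha> i))) < \<epsilon>"
    using A(1) \<epsilon>
  proof (induction A arbitrary: \<epsilon>)
    case empty
    then show ?case by (intro exI[of _ "[]"]) simp
  next
    case (insert \<alpha> A)
    let ?m = "\<lambda>z::complex^'n. \<Prod>i\<in>UNIV. (z $ i) ^ \<alpha> i"
    let ?s = "\<lambda>z::complex^'n. \<Sum>\<alpha>\<in>A. c \<alpha> * (\<Prod>i\<in>UNIV. (z $ i) ^ \<alpha> i)"
    obtain L where L: "\<And>z. z \<in> Q \<Longrightarrow> cmod (rational_polynomial L z - ?s z) < \<epsilon> / 2"
      using insert.IH[of "\<epsilon> / 2"] insert.prems by auto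
    have "compact (?m ` Q)"
      by (intro compact_continuous_image Q continuous_intros)
    from compact_imp_bounded[OF this] obtain B where "B > 0" "\<forall>y\<in>?m ` Q. cmod y \<le> B"
      unfolding bounded_pos by (elim exE conjE)
    then have B: "B > 0" "\<And>z. z \<in> Q \<Longrightarrow> cmod (?m z) \<le> B" by auto
    obtain u v where uv: "cmod (Complex (of_rat u) (of_rat v) - c \<alpha>) < \<epsilon> / 2 / B"
      by (rule complex_rational_approx[of "\<epsilon> / 2 / B" "c \<alpha>"]) (use B insert.prems in auto)
    have "cmod (rational_polynomial ((\<alpha>, u, v) # L) z - (\<Sum>\<alpha>\<in>insert \<alpha> A. c \<alpha> * (\<Prod>i\<in>UNIV. (z $ i) ^ \<alpha> i))) < \<epsilon>"
      if z: "z \<in> Q" for z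
    proof -
      have eq: "rational_polynomial ((\<alpha>, u, v) # L) z - (\<Sum>\<alpha>\<in>insert \<alpha> A. c \<alpha> * (\<Prod>i\<in>UNIV. (z $ i) ^ \<alpha> i)) =
          (Complex (of_rat u) (of_rat v) - c \<alpha>) * ?m z + (rational_polynomial L z - ?s z)"
        using insert.hyps by (simp add: left_diff_distrib)
      have "cmod ((Complex (of_rat u) (of_rat v) - c \<alpha>) * ?m z) \<le> \<epsilon> / 2 / B * B"
        unfolding norm_mult using uv B z insert.prems by (intro mult_mono) auto
      also have "\<dots> = \<epsilon> / 2" using B(1) by simp
      finally show ?thesis
        unfolding eq using L[OF z] by (intro norm_triangle_lt) linarith
    qed
    then show ?case by blast
  qed
  then show ?thesis using that unfolding A(2) by blast
qed

text \<open>Points are closed in a metric space; this makes the event that K takes a given value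
  measurable.\<close>

lemma singleton_in_hausdorff_borel:
  fixes Q :: "'b::metric_space set"
  assumes "Q \<in> nonempty_compacts"
  shows "{Q} \<in> sets hausdorff_borel"
proof -
  interpret Metric_space "nonempty_compacts :: 'b set set" hausdorff_dist by (rule Metric_space_hausdorff)
  have "closedin mtopology {Q}"
    using closedin_Hausdorff_sing_eq[OF Hausdorff_space_mtopology] assms by simp
  then have "openin mtopology (nonempty_compacts - {Q})"
    using openin_diff by (metis openin_topspace topspace_mtopology)
  then have "nonempty_compacts - {Q} \<in> sets hausdorff_borel"
    unfolding hausdorff_borel_def
    by (subst sets_measure_of) (use openin_subset topspace_mtopology in blast)+
  then have "space hausdorff_borel - (nonempty_compacts - {Q}) \<in> sets hausdorff_borel"
    by (rule sets.compl_sets)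
  moreover have "space hausdorff_borel - (nonempty_compacts - {Q}) = {Q}" using assms by auto
  ultimately show ?thesis by simp
qed

text \<open>A strict bound at each point of a dense set does not bound the supremum strictly; a
  uniform margin \<open>1 / real (Suc n)\<close> does, at the price of a countable union.\<close>

lemma sup_norm_on_less_iff:
  fixes Q :: "'b::metric_space set"
  assumes Q: "compact Q" "Q \<noteq> {}" and g: "continuous_on Q g" and D: "D \<subseteq> Q" "Q \<subseteq> closure D"
  shows "sup_norm_on Q g < e \<longleftrightarrow> (\<exists>n. \<forall>d\<in>D. cmod (g d) \<le> e - 1 / real (Suc n))"
proof
  assume "sup_norm_on Q g < e"
  then obtain n where n: "1 / real (Suc n) < e - sup_norm_on Q g"
    using nat_approx_posE[of "e - sup_norm_on Q g"] by auto
  have "cmod (g d) \<le> e - 1 / real (Suc n)" if "d \<in> D" for d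
    using cmod_le_sup_norm_on[OF Q(1) g] that D(1) n by fastforce
  then show "\<exists>n. \<forall>d\<in>D. cmod (g d) \<le> e - 1 / real (Suc n)" by blast
next
  assume "\<exists>n. \<forall>d\<in>D. cmod (g d) \<le> e - 1 / real (Suc n)"
  then obtain n where n: "\<And>d. d \<in> D \<Longrightarrow> cmod (g d) \<le> e - 1 / real (Suc n)" by blast
  have "Q = closure D" using D closure_minimal[OF D(1) compact_imp_closed[OF Q(1)]] by blast
  then have "cmod (g x) \<le> e - 1 / real (Suc n)" if "x \<in> Q" for x
    using continuous_on_closure_norm_le[of D g "e - 1 / real (Suc n)" x] g n that by auto
  then have "sup_norm_on Q g \<le> e - 1 / real (Suc n)"
    unfolding sup_norm_on_def using Q(2) by (intro cSUP_least)
  also have "\<dots> < e" by simp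
  finally show "sup_norm_on Q g < e" .
qed

lemma holomorphic_near_continuous_on: "holomorphic_near g Q \<Longrightarrow> continuous_on Q g"
proof -
  assume "holomorphic_near g Q"
  then obtain U h where U: "Q \<subseteq> U" "holomorphic_several h U" "\<And>z. z \<in> Q \<Longrightarrow> g z = h z"
    unfolding holomorphic_near_def by auto
  have "continuous_on Q h"
    using U(1,2) unfolding holomorphic_several_def
    by (meson continuous_at_imp_continuous_on has_derivative_continuous subsetD)
  then show ?thesis using U(3) by (simp cong: continuous_on_cong_simp)
qed

theorem theorem5p12:
  fixes M :: "'a measure"
    and K :: "'a \<Rightarrow> (complex^'n) set"
    and f :: "'a \<Rightarrow> complex^'n \<Rightarrow> complex"
    and \<epsilon> :: "'a \<Rightarrow> real"
  assumes "sigma_finite_measure M"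
    and "random_compact_set M K"
    and "countable (K ` space M)"
    and "\<And>\<omega>. \<omega> \<in> space M \<Longrightarrow> K \<omega> = polynomial_hull (K \<omega>)"
    and "generalized_random_function M K f"
    and "\<And>\<omega>. \<omega> \<in> space M \<Longrightarrow> holomorphic_near (f \<omega>) (K \<omega>)"
    and "\<epsilon> \<in> borel_measurable M"
    and "\<And>\<omega>. \<omega> \<in> space M \<Longrightarrow> 0 < \<epsilon> \<omega>"
  shows "\<exists>p. generalized_random_polynomial M K p \<and>
           (\<exists>L\<in>sets M. emeasure M L = 0 \<and>
              (\<forall>\<omega>\<in>space M - L. sup_norm_on (K \<omega>) (\<lambda>z. p \<omega> z - f \<omega> z) < \<epsilon> \<omega>))"
proof -
  define q :: "nat \<Rightarrow> complex^'n \<Rightarrow> complex" where "q j = rational_polynomial (from_nat j)" for j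
  have q_poly: "complex_polynomial (q j)" for j
    by (simp add: q_def complex_polynomial_rational)
  have Km: "K \<in> M \<rightarrow>\<^sub>M hausdorff_borel" using assms(2) by (simp add: random_compact_set_def)
  have Kne: "compact (K \<omega>)" "K \<omega> \<noteq> {}" if "\<omega> \<in> space M" for \<omega>
    using measurable_space[OF Km that] by (simp_all add: nonempty_compacts_def)
  define piece where "piece Q = {\<omega> \<in> space M. K \<omega> = Q}" for Q
  have piece_sets: "piece Q \<in> sets M" if "Q \<in> K ` space M" for Q
  proof -
    have "Q \<in> nonempty_compacts" using that Kne by (auto simp: nonempty_compacts_def)
    from measurable_sets[OF Km singleton_in_hausdorff_borel[OF this]]
    show ?thesis by (simp add: piece_def vimage_def Int_def conj_commute)
  qed
  have cont: "continuous_on (K \<omega>) (\<lambda>z. q j z - f \<omega> z)" if "\<omega> \<in> space M" for \<omega> j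
    by (intro continuous_on_diff continuous_on_complex_polynomial q_poly holomorphic_near_continuous_on assms(6) that)
  have fibre_sets: "fibre M K z \<in> sets M" for z
  proof -
    have "fibre M K z = (\<Union>Q\<in>{Q \<in> K ` space M. z \<in> Q}. piece Q)"
      by (auto simp: fibre_def piece_def)
    also have "\<dots> \<in> sets M"
      using assms(3) piece_sets by (intro sets.countable_UN') auto
    finally show ?thesis .
  qed
  have point: "{\<omega> \<in> fibre M K z. cmod (q j z - f \<omega> z) \<le> \<epsilon> \<omega> - c} \<in> sets M" for j z c
  proof (cases "fibre M K z = {}")
    case False
    let ?N = "restrict_space M (fibre M K z)"
    have [measurable]: "(\<lambda>\<omega>. f \<omega> z) \<in> borel_measurable ?N"
      using assms(5) False by (simp add: generalized_random_function_def)
    have [measurable]: "\<epsilon> \<in> borel_measurable ?N" by (rule measurable_restrict_space1[OF assms(7)])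
    have "{\<omega> \<in> space ?N. cmod (q j z - f \<omega> z) \<le> \<epsilon> \<omega> - c} \<in> sets ?N" by measurable
    moreover have "space ?N = fibre M K z"
      using sets.sets_into_space[OF fibre_sets] by (auto simp: space_restrict_space)
    ultimately show ?thesis using fibre_sets by (simp add: sets_restrict_space_iff)
  qed simp
  let ?P = "\<lambda>j \<omega>. sup_norm_on (K \<omega>) (\<lambda>z. q j z - f \<omega> z) < \<epsilon> \<omega>"
  have "{\<omega> \<in> space M. ?P j \<omega>} \<in> sets M" for j
  proof -
    have "{\<omega> \<in> piece Q. ?P j \<omega>} \<in> sets M" if Q: "Q \<in> K ` space M" for Q
    proof -
      have cQ: "compact Q" "Q \<noteq> {}" using Q Kne by auto
      obtain D where D: "countable D" "D \<subseteq> Q" "Q \<subseteq> closure D" by (rule separable[of Q])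
      have "D \<noteq> {}" using D cQ by auto
      \<comment> \<open>\<open>f \<omega> d\<close> is measurable in \<omega> only on the fibre of
        d, whence the restriction; on \<open>piece Q\<close> nothing is lost, as every d in D lies
        in Q.\<close>
      let ?S = "\<lambda>n d. {\<omega> \<in> fibre M K d. cmod (q j d - f \<omega> d) \<le> \<epsilon> \<omega> - 1 / real (Suc n)}"
      have "(\<Inter>d\<in>D. ?S n d) \<in> sets M" for n
        by (rule sets.countable_INT'[OF D(1) \<open>D \<noteq> {}\<close>]) (intro image_subsetI point)
      then have UN: "(\<Union>n. \<Inter>d\<in>D. ?S n d) \<in> sets M"
        by (intro sets.countable_UN image_subsetI)
      have iff: "?P j \<omega> \<longleftrightarrow> (\<exists>n. \<forall>d\<in>D. cmod (q j d - f \<omega> d) \<le> \<epsilon> \<omega> - 1 / real (Suc n))"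
        if "\<omega> \<in> piece Q" for \<omega>
        using sup_norm_on_less_iff[OF cQ _ D(2,3), of "\<lambda>z. q j z - f \<omega> z" "\<epsilon> \<omega>"] cont[of \<omega> j] that
        by (simp add: piece_def)
      have fib: "\<omega> \<in> fibre M K d" if "\<omega> \<in> piece Q" "d \<in> D" for \<omega> d
        using that D(2) by (auto simp: piece_def fibre_def)
      have "{\<omega> \<in> piece Q. ?P j \<omega>} =
          {\<omega> \<in> piece Q. \<exists>n. \<forall>d\<in>D. cmod (q j d - f \<omega> d) \<le> \<epsilon> \<omega> - 1 / real (Suc n)}"
        by (rule Collect_cong, rule conj_cong[OF refl iff])
      also have "\<dots> = piece Q \<inter> (\<Union>n. \<Inter>d\<in>D. ?S n d)"
        by (auto simp: fib simp del: of_nat_Suc)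
      also have "\<dots> \<in> sets M" by (rule sets.Int[OF piece_sets[OF Q] UN])
      finally show ?thesis .
    qed
    then have "(\<Union>Q\<in>K ` space M. {\<omega> \<in> piece Q. ?P j \<omega>}) \<in> sets M"
      by (intro sets.countable_UN'[OF assms(3)] image_subsetI)
    moreover have "{\<omega> \<in> space M. ?P j \<omega>} = (\<Union>Q\<in>K ` space M. {\<omega> \<in> piece Q. ?P j \<omega>})"
      by (auto simp: piece_def)
    ultimately show ?thesis by (simp only:)
  qed
  then have "Measurable.pred M (?P j)" for j by (simp add: pred_def)
  then have J: "(\<lambda>\<omega>. LEAST j. ?P j \<omega>) \<in> M \<rightarrow>\<^sub>M count_space UNIV" by (rule measurable_Least)
  define p where "p \<omega> = q (LEAST j. ?P j \<omega>)" for \<omega>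
  have "\<exists>j. ?P j \<omega>" if w: "\<omega> \<in> space M" for \<omega>
  proof -
    \<comment> \<open>Two errors below \<open>\<epsilon> \<omega> / 4\<close>, from Oka--Weil and
      from rational coefficients, keep the inequality strict after passing to the supremum.\<close>
    have e: "\<epsilon> \<omega> / 4 > 0" using assms(8)[OF w] by simp
    obtain r where r: "complex_polynomial r" "\<And>z. z \<in> K \<omega> \<Longrightarrow> cmod (r z - f \<omega> z) < \<epsilon> \<omega> / 4"
      by (rule Oka_Weil[OF Kne[OF w] assms(4)[OF w] assms(6)[OF w] e]) (rule that)
    obtain L where L: "\<And>z. z \<in> K \<omega> \<Longrightarrow> cmod (rational_polynomial L z - r z) < \<epsilon> \<omega> / 4"
      by (rule rational_polynomial_dense[OF Kne(1)[OF w] r(1) e]) (rule that)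
    have "cmod (q (to_nat L) z - f \<omega> z) \<le> \<epsilon> \<omega> / 2" if "z \<in> K \<omega>" for z
      using r(2)[OF that] L[OF that] norm_triangle_ineq[of "q (to_nat L) z - r z" "r z - f \<omega> z"]
      by (simp add: q_def)
    then have "sup_norm_on (K \<omega>) (\<lambda>z. q (to_nat L) z - f \<omega> z) \<le> \<epsilon> \<omega> / 2"
      unfolding sup_norm_on_def using Kne(2)[OF w] by (intro cSUP_least)
    also have "\<dots> < \<epsilon> \<omega>" using assms(8)[OF w] by simp
    finally show ?thesis by blast
  qed
  then have approx: "sup_norm_on (K \<omega>) (\<lambda>z. p \<omega> z - f \<omega> z) < \<epsilon> \<omega>" if "\<omega> \<in> space M" for \<omega>
    unfolding p_def using that by (intro LeastI_ex[of "\<lambda>j. ?P j \<omega>"])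
  \<comment> \<open>For fixed z the value depends on \<omega> only through the measurable
    natural-number index.\<close>
  have "(\<lambda>\<omega>. p \<omega> z) \<in> borel_measurable M" for z
    unfolding p_def using measurable_compose[OF J, of "\<lambda>j. q j z" borel] by simp
  then have "generalized_random_function M K p"
    unfolding generalized_random_function_def by (auto intro: measurable_restrict_space1)
  then have "generalized_random_polynomial M K p"
    unfolding generalized_random_polynomial_def using q_poly by (auto simp: p_def)
  then show ?thesis using approx by (intro exI[of _ p] conjI bexI[of _ "{}"]) auto
qed

end
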